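(* Let $n\geq 6$. A permutation $\pi\in\mathfrak{S}_n$ has stack sorting complexity exactly $n-3$ (i.e. $\pi\in E_{n,n-3}$) if and only if $\pi$ belongs to at least one of the following sets of words (intersected with $\mathfrak{S}_n$), written in glob notation: 1(a) $\langle \ast (n-1)2n\rangle$; 1(b) $\langle \ast(n-1)?1n\rangle$; 1(c) $\langle\ast(n-1)1?n\rangle$; 1(d) $\langle\ast(n-1)\ast(n-3)\ast(n-2)1n\rangle$; 1(e) $\langle\ast(n-2)1(n-1)n\rangle$; 2(a) $\langle\ast n3\rangle$; 2(b) $\langle\ast(n-1)1n?\rangle$; 2(c) $\langle\ast(n-2)1n(n-1)\rangle$; 3(a) $\langle\ast n2?\rangle$; 3(b) $\langle\ast n?2\rangle$; 4(a) $\langle\ast n??1\rangle$ minus $\langle\ast n(n-2)(n-1)1\rangle$; 4(b) $\langle\ast n?1?\rangle$; 4(c) $\langle\ast n1??\rangle$; 4(d) $\langle\ast n(n-2)(n-1)2\rangle$; 5(a) words of the form $X\,n\,A\,(n-2)\,B\,(n-1)\,2$ where $X,A,B$ are words and $A,B$ are not both empty; 5(b) $\langle\ast n\ast(n-3)\ast(n-1)(n-2)1\rangle$; 5(c) $\langle\ast n\ast(n-1)\ast(n-3)\ast(n-2)1\rangle$; 5(d) $\langle\ast(n-1)\ast n\ast(n-3)\ast(n-4)\ast(n-2)1\rangle\cup\langle\ast(n-1)\ast n\ast(n-4)\ast(n-3)\ast(n-2)1\rangle$; 5(e) $\langle\ast n\ast(n-2)\ast(n-1)1?\rangle\cup\langle\ast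 n\ast(n-2)\ast(n-1)?1\rangle$; 5(f) $\langle\ast n\ast(n-3)\ast(n-1)1(n-2)\rangle$; 5(g) $\langle\ast n\ast(n-3)\ast(n-2)1(n-1)\rangle$; 5(h) $\langle\ast(n-2)\ast n\ast(n-3)\ast(n-4)\ast(n-1)1\rangle\cup\langle\ast(n-2)\ast n\ast(n-4)\ast(n-3)\ast(n-1)1\rangle$. Moreover, the number of permutations in $E_{n,n-3}$ is $$\frac{(n-4)!}{3}\left(47\binom{n-6}{2}+194\binom{n-6}{1}+297\right).$$
   Context: Permutations are written as words $\pi=\pi_1\cdots\pi_n$ without repeated letters; $\mathfrak{S}_n$ is the set of permutations of $\{1,\dots,n\}$. The stack sorting operator $S$ is defined recursively on permutations of finite subsets of $\{1,2,\dots\}$: if $\pi$ is empty, $S(\pi)=\pi$; otherwise write $\pi=LmR$ where $m$ is the largest letter of $\pi$ and $L,R$ are the subwords to its left and right, and set $S(\pi)=S(L)S(R)m$. Let $S^0$ be the identity and $S^k=S\circ S^{k-1}$. The stack sorting complexity of $\pi\in\mathfrak{S}_n$ is the least $k\geq 0$ with $S^k(\pi)=12\cdots n$, and $E_{n,k}$ is the set of $\pi\in\mathfrak{S}_n$ whose complexity is exactly $k$. Glob notation: for a word $w$ over the alphabet $\{\ast,?\}\cup\{1,2,\dots\}$, $\langle w\rangle$ is the set of words over $\{1,2,\dots\}$ obtained from $w$ by replacing each $\ast$ by an arbitrary (possibly empty) word and each $?$ by an arbitrary single letter. For example $\langle\ast n1\rangle$ is the set of words with suffix $n1$.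
   Formalization: The formal statement removes permutations of complexity n-2 from three listed sets: 2(b) minus ⟨*(n-1)1n2⟩, 3(a) minus ⟨*n21⟩, 3(b) minus ⟨*n12⟩; as printed the equivalence fails, e.g. 345621 (n=6) lies in 3(a) but has complexity 4. *)

theory Defs
  imports Complex_Main "HOL-Combinatorics.Multiset_Permutations"
begin

text \<open>Words over the positive integers are values of type \<^typ>\<open>nat list\<close>; the set of
  permutations of \<open>{1,...,n}\<close> is \<open>permutations_of_set {1..n}\<close>, the set of duplicate-free
  words whose set of letters is \<open>{1..n}\<close>.\<close>

abbreviation perms :: "nat \<Rightarrow> nat list set" where
  "perms n \<equiv> permutations_of_set {1..n}"

text \<open>The word \<open>w\<close> is split at (the first occurrence of) its largest letter.  Only words without
  repeated letters matter, for which that occurrence is unique.\<close>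

function stack_sort :: "nat list \<Rightarrow> nat list" where
  "stack_sort w =
     (if w = [] then []
      else let m = Max (set w);
               L = takeWhile (\<lambda>x. x \<noteq> m) w;
               R = tl (dropWhile (\<lambda>x. x \<noteq> m) w)
           in stack_sort L @ stack_sort R @ [m])"
  by pat_completeness auto

termination
proof (relation "measure length")
  fix w :: "nat list" and m L
  assume w: "w \<noteq> []" and m: "m = Max (set w)"
  then have "m \<in> set w" by simp
  then have "dropWhile (\<lambda>x. x \<noteq> m) w \<noteq> []" by (auto simp: dropWhile_eq_Nil_conv)
  then have "length (takeWhile (\<lambda>x. x \<noteq> m) w) < length w"
    by (metis append.right_neutral le_neq_implies_less length_takeWhile_le same_append_eq
        takeWhile_dropWhile_id takeWhile_eq_take take_all_iff order_refl)
  then show "L = takeWhile (\<lambda>x. x \<noteq> m) w \<Longrightarrow> (L, w) \<in> measure length" by simp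
next
  fix w :: "nat list" and m L R
  assume w: "w \<noteq> []"
  have "length (dropWhile (\<lambda>x. x \<noteq> m) w) \<le> length w" by (rule length_dropWhile_le)
  with w show "R = tl (dropWhile (\<lambda>x. x \<noteq> m) w) \<Longrightarrow> (R, w) \<in> measure length"
    by (cases w) auto
qed simp

declare stack_sort.simps [simp del]

lemma stack_sort_Nil [simp]: "stack_sort [] = []"
  by (simp add: stack_sort.simps)

lemma stack_sort_split:
  assumes "\<And>x. x \<in> set L \<Longrightarrow> x < m" and "\<And>x. x \<in> set R \<Longrightarrow> x < m"
  shows "stack_sort (L @ m # R) = stack_sort L @ stack_sort R @ [m]"
proof -
  have "Max (set (L @ m # R)) = m"
    using assms by (intro Max_eqI) (auto intro: less_imp_le)
  moreover have "takeWhile (\<lambda>x. x \<noteq> m) (L @ m # R) = L"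
    "dropWhile (\<lambda>x. x \<noteq> m) (L @ m # R) = m # R"
    using assms by (auto simp: takeWhile_append dropWhile_append)
  ultimately show ?thesis
    by (subst stack_sort.simps) (simp add: Let_def)
qed

text \<open>By \<open>stack_sort_iterate_sorts\<close> below, the \<open>LEAST\<close> is over a nonempty set
  whenever \<open>\<pi> \<in> perms n\<close>.\<close>

definition stack_complexity :: "nat \<Rightarrow> nat list \<Rightarrow> nat" where
  "stack_complexity n \<pi> = (LEAST k. (stack_sort ^^ k) \<pi> = [1..<n + 1])"

definition E :: "nat \<Rightarrow> nat \<Rightarrow> nat list set" where
  "E n k = {\<pi> \<in> perms n. stack_complexity n \<pi> = k}"

lemma stack_sort_perm:
  "distinct w \<Longrightarrow> set (stack_sort w) = set w \<and> distinct (stack_sort w)"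
proof (induction "length w" arbitrary: w rule: less_induct)
  case less
  show ?case
  proof (cases "w = []")
    case False
    define m where "m = Max (set w)"
    have "m \<in> set w" using False by (simp add: m_def)
    then obtain L R where w: "w = L @ m # R" by (meson split_list)
    have le: "x \<le> m" if "x \<in> set w" for x using that by (simp add: m_def)
    have lt: "x < m" if "x \<in> set L \<union> set R" for x
      using that le[of x] less.prems w by (cases "x = m") auto
    have "stack_sort w = stack_sort L @ stack_sort R @ [m]"
      unfolding w using lt by (intro stack_sort_split) auto
    moreover have "set (stack_sort L) = set L \<and> distinct (stack_sort L)"
      using less.prems w by (intro less.hyps) auto
    moreover have "set (stack_sort R) = set R \<and> distinct (stack_sort R)"
      using less.prems w by (intro less.hyps) auto
    ultimately show ?thesis using less.prems w by auto
  qed simp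
qed

lemma stack_sort_append_upt:
  "(\<And>x. x \<in> set u \<Longrightarrow> x < a) \<Longrightarrow> stack_sort (u @ [a..<a + d]) = stack_sort u @ [a..<a + d]"
proof (induction d)
  case (Suc d)
  have "stack_sort ((u @ [a..<a + d]) @ (a + d) # []) = stack_sort (u @ [a..<a + d]) @ [a + d]"
    using Suc.prems by (subst stack_sort_split) (auto intro: trans_less_add1)
  then show ?case using Suc by simp
qed simp

lemma stack_sort_last:
  assumes "u \<in> perms (Suc m)"
  shows "\<exists>u' \<in> perms m. stack_sort u = u' @ [Suc m]"
proof -
  have u: "set u = {1..Suc m}" "distinct u"
    using assms by (auto simp: permutations_of_set_def)
  then have "Suc m \<in> set u" by auto
  then obtain L R where LR: "u = L @ Suc m # R" by (meson split_list)
  have lt: "x < Suc m" if "x \<in> set L \<union> set R" for x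
  proof -
    have "x \<in> {1..Suc m}" using that u(1) LR by auto
    moreover have "x \<noteq> Suc m" using that u(2) LR by auto
    ultimately show ?thesis by simp
  qed
  have eq: "stack_sort u = (stack_sort L @ stack_sort R) @ [Suc m]"
    unfolding LR using lt by (subst stack_sort_split) auto
  have "set (stack_sort u) = {1..Suc m}" "distinct (stack_sort u)"
    using stack_sort_perm[OF u(2)] u(1) by auto
  then have "insert (Suc m) (set (stack_sort L @ stack_sort R)) = {1..Suc m}"
    "Suc m \<notin> set (stack_sort L @ stack_sort R)" "distinct (stack_sort L @ stack_sort R)"
    unfolding eq by auto
  then have "set (stack_sort L @ stack_sort R) = {1..Suc m} - {Suc m}" by blast
  also have "\<dots> = {1..m}" by auto
  finally have "stack_sort L @ stack_sort R \<in> perms m"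
    using \<open>distinct (stack_sort L @ stack_sort R)\<close> by (simp add: permutations_of_set_def)
  then show ?thesis using eq by blast
qed

lemma stack_sort_iterate_sorts:
  assumes "\<pi> \<in> perms n"
  shows "(stack_sort ^^ n) \<pi> = [1..<n + 1]"
proof -
  have "\<exists>u \<in> perms (n - j). (stack_sort ^^ j) \<pi> = u @ [n - j + 1..<n - j + 1 + j]" if "j \<le> n" for j
    using that
  proof (induction j)
    case 0
    then show ?case using assms by simp
  next
    case (Suc j)
    then obtain u where u: "u \<in> perms (n - j)"
      "(stack_sort ^^ j) \<pi> = u @ [n - j + 1..<n - j + 1 + j]" by auto
    obtain m where m: "n - j = Suc m" using Suc.prems by (cases "n - j") auto
    obtain u' where u': "u' \<in> perms m" "stack_sort u = u' @ [Suc m]"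
      using stack_sort_last u(1) m by metis
    have "x < n - j + 1" if "x \<in> set u" for x
      using that u(1) by (auto simp: permutations_of_set_def)
    then have "(stack_sort ^^ Suc j) \<pi> = u' @ [Suc m] @ [Suc m + 1..<Suc m + 1 + j]"
      using stack_sort_append_upt[of u "n - j + 1" j] u u' m by simp
    also have "[Suc m] @ [Suc m + 1..<Suc m + 1 + j] = [m + 1..<m + 1 + Suc j]"
      by (simp add: upt_conv_Cons del: upt_Suc)
    finally have "(stack_sort ^^ Suc j) \<pi> = u' @ [m + 1..<m + 1 + Suc j]" .
    moreover have "n - Suc j = m" using m by simp
    ultimately show ?case using u'(1) by metis
  qed
  from this[of n] show ?thesis by (auto simp del: upt_Suc)
qed

text \<open>Glob patterns: \<open>Star\<close> is the wildcard for an arbitrary word, \<open>Any\<close> the wildcard \<open>?\<close> for an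
  arbitrary letter.\<close>

datatype glob_symbol = Star | Any | Lit nat

fun glob :: "glob_symbol list \<Rightarrow> nat list set" where
  "glob [] = {[]}"
| "glob (Star # w) = {u @ v | u v. set u \<subseteq> {1..} \<and> v \<in> glob w}"
| "glob (Any # w) = {a # v | a v. a \<in> {1..} \<and> v \<in> glob w}"
| "glob (Lit a # w) = {a # v | v. v \<in> glob w}"

end

(* Fix a letter a and let U be the word of the letters greater than a that stand to the left of a.
   One stack sorting pass replaces U by stack_out U, the part of S(U) that is written before the final
   emptying of the stack, so a permutation is sorted after k passes iff stack_out^k annihilates U for
   every letter a.  Each application of stack_out shortens U; the defect of U counts how much shorter U
   gets than one letter per pass.  Defect 0, 1 and 2 depend only on the positions of the five largest
   letters of U, by the recursion for defect (L m R), and as n - 3 is close to the maximal complexity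
   n - 1 only the letters a = 1, 2, 3 matter, with small defects.  Hence membership in E n (n - 3) is a
   condition on the positions of 1, 2, 3, n - 4, ..., n, and so are the glob patterns.  For the count,
   the indicator function of this condition is a signed sum of indicator functions of conditions that
   prescribe the positions of k letters and the relative order of j others, and
   (n - k)! / j! permutations satisfy such a condition. *)

theory Submission
  imports Defs
begin

section \<open>Stack sorting and the letters to the left of a given letter\<close>

text \<open>For U = L m R with maximum m, one pass leaves S(L) followed by the output of R. All
  right-to-left maxima disappear at once, and each one beyond the first adds 1 to the defect, so
  defect 2 allows at most three of them. The blocks that remain are outputs of S and end in their
  own maxima, so what happens next is decided by which block holds the largest letter. The longest
  case removes two right-to-left maxima in the first pass and two in the second, after which one
  more comparison decides; this is where five letters come from. They have to exceed the letter 1,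
  which is where n >= 6 comes from. A letter a also saves a pass for each greater letter to its
  right, because U misses that letter; \<open>lag\<close> adds this number to the defect. For a = 2
  and a = 3 the criterion concerns the word without the smaller letters. The deletion shifts
  positions, and the translation back to positions in the full word causes the large case
  analyses.\<close>

lemma split_at_max:
  fixes w :: "nat list"
  assumes "w \<noteq> []" "distinct w"
  obtains L m R where "w = L @ m # R" "\<forall>x\<in>set L \<union> set R. x < m"
proof -
  define m where "m = Max (set w)"
  have "m \<in> set w" using assms(1) by (simp add: m_def)
  then obtain L R where w: "w = L @ m # R" by (meson split_list)
  have "x \<le> m" if "x \<in> set w" for x using that by (simp add: m_def)
  then have "\<forall>x\<in>set L \<union> set R. x < m"
    using assms(2) unfolding w by (auto simp: order_less_le)
  with w that show thesis by blast
qed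

lemma split_at_max_induct [consumes 1, case_names Nil split]:
  fixes w :: "nat list"
  assumes "distinct w"
    and "P []"
    and "\<And>L m R. \<lbrakk>distinct (L @ m # R); \<forall>x\<in>set L. x < m; \<forall>x\<in>set R. x < m; P L; P R\<rbrakk> \<Longrightarrow> P (L @ m # R)"
  shows "P w"
  using assms(1)
proof (induction "length w" arbitrary: w rule: less_induct)
  case less
  show ?case
  proof (cases "w = []")
    case False
    then obtain L m R where w: "w = L @ m # R" and m: "\<forall>x\<in>set L \<union> set R. x < m"
      using split_at_max less.prems by blast
    have "P L" "P R" using less w by auto
    then show ?thesis using assms(3)[of L m R] less.prems m unfolding w by blast
  qed (simp add: assms(2))
qed

lemma set_stack_sort [simp]: "distinct w \<Longrightarrow> set (stack_sort w) = set w"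
  and distinct_stack_sort [simp]: "distinct w \<Longrightarrow> distinct (stack_sort w)"
  using stack_sort_perm by blast+

lemma length_stack_sort [simp]: "distinct w \<Longrightarrow> length (stack_sort w) = length w"
  by (metis distinct_card set_stack_sort distinct_stack_sort)

lemma stack_sort_eq_Nil_iff [simp]: "distinct w \<Longrightarrow> stack_sort w = [] \<longleftrightarrow> w = []"
  by (metis length_0_conv length_stack_sort)

text \<open>As long as the maximum m exceeds \<open>a\<close>, the recursion splits at the same
  letter before and after the deletion; once m <= a, nothing survives on either side. So letters up
  to \<open>a\<close> have no influence on the order of the greater ones.\<close>

lemma stack_sort_filter_greater:
  "distinct w \<Longrightarrow> stack_sort (filter ((<) a) w) = filter ((<) a) (stack_sort w)"
proof (induction w rule: split_at_max_induct)
  case (split L m R)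
  show ?case
  proof (cases "a < m")
    case True
    have "stack_sort (filter ((<) a) L @ m # filter ((<) a) R)
        = stack_sort (filter ((<) a) L) @ stack_sort (filter ((<) a) R) @ [m]"
      using split by (intro stack_sort_split) auto
    then show ?thesis using split True by (simp add: stack_sort_split)
  next
    case False
    then have "filter ((<) a) L = []" "filter ((<) a) R = []"
      using split by (auto simp: filter_empty_conv)
    then show ?thesis using split False by (simp add: stack_sort_split)
  qed
qed simp

section \<open>What a pass has written before a given letter\<close>

fun rl_maxima :: "nat list \<Rightarrow> nat set" where
  "rl_maxima [] = {}"
| "rl_maxima (x # w) = (if \<forall>y\<in>set w. y < x then insert x (rl_maxima w) else rl_maxima w)"

lemma rl_maxima_subset: "rl_maxima w \<subseteq> set w"
  by (induction w) auto

lemma rl_maxima_split: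
  assumes "\<forall>x\<in>set L. x < m" "\<forall>x\<in>set R. x < m"
  shows "rl_maxima (L @ m # R) = insert m (rl_maxima R)"
  using assms by (induction L) auto

text \<open>The right-to-left maxima are the letters still on the stack when the input is exhausted, so
  this is the output written before the final emptying of the stack.\<close>

definition stack_out :: "nat list \<Rightarrow> nat list" where
  "stack_out w = filter (\<lambda>x. x \<notin> rl_maxima w) (stack_sort w)"

lemma stack_out_Nil [simp]: "stack_out [] = []"
  by (simp add: stack_out_def)

text \<open>The arrival of \<open>m\<close> pops whatever is left of \<open>L\<close>, and
  \<open>m\<close> then stays at the bottom of the stack until the input ends. So \<open>L\<close>
  is written out completely, while \<open>R\<close> keeps its right-to-left maxima on the
  stack.\<close>

lemma stack_out_split:
  assumes "distinct (L @ m # R)" "\<forall>x\<in>set L. x < m" "\<forall>x\<in>set R. x < m"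
  shows "stack_out (L @ m # R) = stack_sort L @ stack_out R"
proof -
  have "filter (\<lambda>x. x \<notin> insert m (rl_maxima R)) (stack_sort L) = stack_sort L"
    using assms rl_maxima_subset[of R] by (auto simp: filter_id_conv)
  moreover have "filter (\<lambda>x. x \<notin> insert m (rl_maxima R)) (stack_sort R) = stack_out R"
    unfolding stack_out_def using assms by (auto intro!: filter_cong)
  ultimately show ?thesis
    using assms by (simp add: stack_out_def rl_maxima_split stack_sort_split)
qed

lemma distinct_stack_out [simp]: "distinct w \<Longrightarrow> distinct (stack_out w)"
  by (simp add: stack_out_def)

text \<open>The maximum is still on the stack when the input ends, so at least this letter is
  missing from the output.\<close>

lemma length_stack_out_less:
  assumes "distinct w" "w \<noteq> []"
  shows "length (stack_out w) < length w"
  using assms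
proof (induction w rule: split_at_max_induct)
  case (split L m R)
  then have "length (stack_out R) \<le> length R"
    by (cases "R = []") auto
  then show ?case using split by (simp add: stack_out_split)
qed simp

definition greater_before :: "nat \<Rightarrow> nat list \<Rightarrow> nat list" where
  "greater_before a w = filter ((<) a) (takeWhile (\<lambda>x. x \<noteq> a) w)"

lemma distinct_greater_before [simp]: "distinct w \<Longrightarrow> distinct (greater_before a w)"
  by (simp add: greater_before_def distinct_takeWhile)

lemma greater_before_append:
  "greater_before a (u @ v) = (if a \<in> set u then greater_before a u else filter ((<) a) u @ greater_before a v)"
  by (auto simp: greater_before_def takeWhile_append)

text \<open>When \<open>a\<close> is read, the greater letters still on the stack are the
  right-to-left maxima of \<open>greater_before a w\<close>. They lie below \<open>a\<close> and
  leave after it, while the other letters of that word are already out.\<close>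

lemma greater_before_stack_sort:
  "distinct w \<Longrightarrow> a \<in> set w \<Longrightarrow> greater_before a (stack_sort w) = stack_out (greater_before a w)"
proof (induction w rule: split_at_max_induct)
  case (split L m R)
  have S: "stack_sort (L @ m # R) = stack_sort L @ stack_sort R @ [m]"
    using split by (simp add: stack_sort_split)
  consider "a \<in> set L" | "a = m" | "a \<in> set R" using split.prems by auto
  then show ?case
  proof cases
    case 1
    then show ?thesis using split by (simp add: S greater_before_append)
  next
    case 2
    then have "filter ((<) a) L = []" "filter ((<) a) R = []"
      using split by (auto simp: filter_empty_conv)
    moreover have "greater_before m (m # R) = []" "greater_before m [m] = []"
      by (simp_all add: greater_before_def)
    ultimately show ?thesis using 2 split
      by (simp add: S greater_before_append flip: stack_sort_filter_greater)
  next
    case 3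
    have am: "a < m" using 3 split by auto
    have "greater_before a (L @ m # R) = filter ((<) a) L @ m # greater_before a R"
      using 3 am split by (auto simp: greater_before_append) (auto simp: greater_before_def)
    moreover have "stack_out \<dots> = stack_sort (filter ((<) a) L) @ stack_out (greater_before a R)"
      using split by (intro stack_out_split) (auto simp: greater_before_def distinct_takeWhile dest: set_takeWhileD)
    moreover have "a \<notin> set L" using 3 split by auto
    ultimately show ?thesis using 3 split am
      by (simp add: S greater_before_append stack_sort_filter_greater)
  qed
qed simp

lemma funpow_stack_sort_perm:
  "distinct w \<Longrightarrow> set ((stack_sort ^^ k) w) = set w \<and> distinct ((stack_sort ^^ k) w)"
  by (induction k) auto

lemma greater_before_funpow_stack_sort:
  "distinct w \<Longrightarrow> a \<in> set w \<Longrightarrow>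
    greater_before a ((stack_sort ^^ k) w) = (stack_out ^^ k) (greater_before a w)"
  by (induction k) (simp_all add: greater_before_stack_sort funpow_stack_sort_perm)

lemma sorted_iff_greater_before:
  "distinct w \<Longrightarrow> sorted w \<longleftrightarrow> (\<forall>a\<in>set w. greater_before a w = [])"
proof (induction w)
  case (Cons x w)
  have "greater_before x (x # w) = []" by (simp add: greater_before_def)
  moreover have "greater_before a (x # w) = [] \<longleftrightarrow> x \<le> a \<and> greater_before a w = []"
    if "a \<in> set w" for a
    using that Cons.prems by (auto simp: greater_before_def)
  ultimately show ?case using Cons by auto
qed simp

section \<open>Passes needed for each letter, and the complexity as their maximum\<close>

definition passes :: "nat list \<Rightarrow> nat" where
  "passes w = (LEAST k. (stack_out ^^ k) w = [])"

lemma funpow_stack_out_Nil [simp]: "(stack_out ^^ k) [] = []"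
  by (induction k) auto

lemma funpow_stack_out_mono:
  assumes "(stack_out ^^ j) w = []" "j \<le> k"
  shows "(stack_out ^^ k) w = []"
proof -
  obtain i where "k = i + j" using assms(2) by (metis le_add_diff_inverse2)
  then show ?thesis using assms(1) by (simp add: funpow_add)
qed

lemma funpow_stack_out_length:
  "distinct w \<Longrightarrow> length w \<le> k \<Longrightarrow> (stack_out ^^ k) w = []"
proof (induction k arbitrary: w)
  case (Suc k)
  show ?case
  proof (cases "w = []")
    case False
    then have "length (stack_out w) \<le> k" using Suc.prems length_stack_out_less[of w] by simp
    then have "(stack_out ^^ k) (stack_out w) = []" using Suc by simp
    then show ?thesis by (simp add: funpow_swap1)
  qed simp
qed simp

lemma passes_le_iff:
  assumes "distinct w"
  shows "passes w \<le> k \<longleftrightarrow> (stack_out ^^ k) w = []"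
proof
  assume "passes w \<le> k"
  moreover have "(stack_out ^^ passes w) w = []"
    unfolding passes_def using funpow_stack_out_length[OF assms order_refl] by (rule LeastI)
  ultimately show "(stack_out ^^ k) w = []" using funpow_stack_out_mono by blast
next
  assume "(stack_out ^^ k) w = []"
  then show "passes w \<le> k" unfolding passes_def by (rule Least_le)
qed

lemma passes_Nil [simp]: "passes [] = 0"
  using passes_le_iff[of "[]" 0] by simp

lemma passes_le_length: "distinct w \<Longrightarrow> passes w \<le> length w"
  by (simp add: passes_le_iff funpow_stack_out_length)

lemma passes_stack_out:
  assumes "distinct w" "w \<noteq> []"
  shows "passes w = Suc (passes (stack_out w))"
proof -
  have "passes w \<le> Suc k \<longleftrightarrow> passes (stack_out w) \<le> k" for k
    using assms by (simp add: passes_le_iff funpow_swap1)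
  \<comment> \<open>The two numbers are compared through their upper bounds: the first instance
    gives one inequality, and the second gives the other once \<open>passes w\<close> is known to be
    positive, which holds because \<open>w\<close> is nonempty.\<close>
  from this[of "passes (stack_out w)"] this[of "passes w - 1"]
  show ?thesis using passes_le_iff[OF assms(1), of 0] assms(2) by (cases "passes w") auto
qed

lemma eq_upt_iff_sorted:
  assumes "distinct w" "set w = {1..n}"
  shows "w = [1..<n + 1] \<longleftrightarrow> sorted w"
proof
  assume "sorted w"
  moreover have "set w = set [1..<n + 1]" unfolding assms(2) set_upt by auto
  ultimately show "w = [1..<n + 1]"
    using assms(1) by (metis sorted_distinct_set_unique sorted_upt distinct_upt)
next
  assume "w = [1..<n + 1]"
  then show "sorted w" by (simp only: sorted_upt)
qed

text \<open>Sortedness means that no letter has a greater one before it. Each word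
  \<open>greater_before a \<pi>\<close> evolves on its own under \<open>stack_out\<close> and stays
  empty once it is empty, so k passes sort the permutation iff they exhaust all of these
  words.\<close>

lemma stack_complexity_le_iff:
  assumes "\<pi> \<in> perms n"
  shows "stack_complexity n \<pi> \<le> k \<longleftrightarrow> (\<forall>a\<in>{1..n}. passes (greater_before a \<pi>) \<le> k)"
proof -
  have \<pi>: "distinct \<pi>" "set \<pi> = {1..n}" using assms by (auto simp: permutations_of_set_def)
  have id_iff: "(stack_sort ^^ j) \<pi> = [1..<n + 1] \<longleftrightarrow> (\<forall>a\<in>{1..n}. passes (greater_before a \<pi>) \<le> j)" for j
  proof -
    let ?w = "(stack_sort ^^ j) \<pi>"
    have w: "distinct ?w" "set ?w = {1..n}" using funpow_stack_sort_perm \<pi> by auto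
    have "?w = [1..<n + 1] \<longleftrightarrow> sorted ?w"
      using w by (rule eq_upt_iff_sorted)
    also have "\<dots> \<longleftrightarrow> (\<forall>a\<in>{1..n}. greater_before a ?w = [])"
      using sorted_iff_greater_before[OF w(1)] w(2) by simp
    finally show ?thesis
      using \<pi> by (simp add: greater_before_funpow_stack_sort passes_le_iff)
  qed
  show ?thesis
  proof
    assume "stack_complexity n \<pi> \<le> k"
    moreover have "(stack_sort ^^ stack_complexity n \<pi>) \<pi> = [1..<n + 1]"
      unfolding stack_complexity_def using stack_sort_iterate_sorts[OF assms] by (rule LeastI)
    ultimately show "\<forall>a\<in>{1..n}. passes (greater_before a \<pi>) \<le> k"
      using id_iff by (meson order_trans)
  next
    assume "\<forall>a\<in>{1..n}. passes (greater_before a \<pi>) \<le> k"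
    then have "(stack_sort ^^ k) \<pi> = [1..<n + 1]" using id_iff by blast
    then show "stack_complexity n \<pi> \<le> k"
      unfolding stack_complexity_def by (rule Least_le)
  qed
qed

section \<open>Words of defect at most two\<close>

text \<open>By \<open>passes_le_length\<close> the subtraction is not truncated on duplicate-free
  words.\<close>

definition defect :: "nat list \<Rightarrow> nat" where
  "defect w = length w - passes w"

lemma defect_Nil [simp]: "defect [] = 0"
  by (simp add: defect_def)

lemma length_eq_passes_defect: "distinct w \<Longrightarrow> length w = passes w + defect w"
  using passes_le_length by (simp add: defect_def)

text \<open>The pass itself pays for the loss of \<open>m\<close>. Every letter that
  \<open>R\<close> loses in the same pass is lost for free and counts towards the defect, and the
  rest of the defect comes from the word that remains.\<close>

lemma defect_split:
  assumes "distinct (L @ m # R)" "\<forall>x\<in>set L. x < m" "\<forall>x\<in>set R. x < m"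
  shows "defect (L @ m # R) = (length R - length (stack_out R)) + defect (stack_sort L @ stack_out R)"
proof -
  let ?T = "stack_sort L @ stack_out R"
  have T: "stack_out (L @ m # R) = ?T" using assms by (rule stack_out_split)
  then have "distinct ?T" using assms(1) by (metis distinct_stack_out)
  then have "length L + length (stack_out R) = passes ?T + defect ?T"
    using length_eq_passes_defect[of ?T] assms by simp
  moreover have "passes (L @ m # R) = Suc (passes ?T)"
    using passes_stack_out[OF assms(1)] T by simp
  moreover have "length (stack_out R) \<le> length R"
    using length_stack_out_less[of R] assms by (cases "R = []") auto
  ultimately show ?thesis by (simp add: defect_def)
qed

text \<open>Positions are counted from the right end of the word, starting with 0.\<close>

definition pos :: "nat list \<Rightarrow> nat \<Rightarrow> nat" where
  "pos w a = length (takeWhile (\<lambda>x. x \<noteq> a) (rev w))"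

text \<open>A letter that does not occur gets the length of the word as its position; with this
  default the formula covers every \<open>a\<close>.\<close>

lemma pos_append: "pos (u @ v) a = (if a \<in> set v then pos v a else length v + pos u a)"
  by (auto simp: pos_def takeWhile_append)

lemma pos_Cons:
  "pos (x # w) a = (if a \<in> set w then pos w a else if x = a then length w else Suc (length w))"
  using pos_append[of "[x]" w a] by (auto simp: pos_def)

lemma pos_split [simp]: "a \<notin> set v \<Longrightarrow> pos (u @ a # v) a = length v"
  by (simp add: pos_append pos_Cons)

lemma pos_Nil [simp]: "pos [] a = 0"
  by (simp add: pos_def)

lemma pos_less_length: "a \<in> set w \<Longrightarrow> pos w a < length w"
  by (induction w) (auto simp: pos_Cons)

lemma nth_rev_pos: "a \<in> set w \<Longrightarrow> rev w ! pos w a = a"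
  using nth_length_takeWhile[of "\<lambda>x. x \<noteq> a" "rev w"] pos_less_length[of a w] by (simp add: pos_def)

lemma pos_inj: "\<lbrakk>a \<in> set w; b \<in> set w; pos w a = pos w b\<rbrakk> \<Longrightarrow> a = b"
  by (metis nth_rev_pos)

text \<open>If the maximum is last, the pass turns L m into S(L), which again ends in its maximum,
  so exactly one letter is lost per pass forever. If a nonempty \<open>R\<close> follows the
  maximum, then \<open>R\<close> loses a further letter in the first pass.\<close>

lemma defect_eq_0_iff_pos:
  assumes "distinct w" "m \<in> set w" "\<forall>x\<in>set w. x \<le> m"
  shows "defect w = 0 \<longleftrightarrow> pos w m = 0"
proof -
  have "defect (L @ [m]) = 0" if "distinct (L @ [m])" "\<forall>x\<in>set L. x < m" for L m
    using that
  proof (induction "length L" arbitrary: L m rule: less_induct)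
    case less
    show ?case
    proof (cases "L = []")
      case False
      then obtain A k B where L: "L = A @ k # B" "\<forall>x\<in>set A \<union> set B. x < k"
        using split_at_max less.prems by (metis distinct_append)
      then have S: "stack_sort L = (stack_sort A @ stack_sort B) @ [k]"
        by (simp add: stack_sort_split)
      have "defect ((stack_sort A @ stack_sort B) @ [k]) = 0"
        using less.prems L by (intro less.hyps) auto
      then show ?thesis using less.prems S by (simp add: defect_split)
    qed (use less.prems defect_split[of "[]" m "[]"] in simp)
  qed
  moreover have "defect (L @ m # R) > 0"
    if "distinct (L @ m # R)" "\<forall>x\<in>set L. x < m" "\<forall>x\<in>set R. x < m" "R \<noteq> []" for L R
    using that length_stack_out_less[of R] by (simp add: defect_split)
  moreover obtain L R where w: "w = L @ m # R" using assms(2) by (meson split_list)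
  moreover have "\<forall>x\<in>set L. x < m" "\<forall>x\<in>set R. x < m"
    using assms w by (auto simp: order_less_le)
  moreover have "pos w m = length R" using w assms(1) by simp
  ultimately show ?thesis using assms(1) by (cases "R = []") auto
qed

lemma defect_stack_sort [simp]:
  assumes "distinct w"
  shows "defect (stack_sort w) = 0"
proof (cases "w = []")
  case False
  then obtain A k B where w: "w = A @ k # B" "\<forall>x\<in>set A \<union> set B. x < k"
    using split_at_max assms by metis
  then have "stack_sort w = stack_sort A @ stack_sort B @ [k]"
    by (simp add: stack_sort_split)
  then show ?thesis using w assms
    by (subst defect_eq_0_iff_pos[of _ k]) (auto simp: order_less_le pos_append pos_Cons)
qed simp

text \<open>\<open>stack_sort R\<close> ends in the maximum of \<open>R\<close>, so defect 0 means
  that this letter exceeds all of \<open>X\<close>. The existential form spares the applications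
  from naming the maximum.\<close>

lemma defect_append_stack_sort_eq_0_iff:
  assumes "distinct (X @ R)" "R \<noteq> []"
  shows "defect (X @ stack_sort R) = 0 \<longleftrightarrow> (\<exists>y\<in>set R. \<forall>x\<in>set X. x < y)"
proof -
  obtain A k B where R: "R = A @ k # B" and k: "\<forall>x\<in>set A \<union> set B. x < k"
    using split_at_max assms by (metis distinct_append)
  have S: "stack_sort R = stack_sort A @ stack_sort B @ [k]"
    using k by (simp add: R stack_sort_split)
  show ?thesis
  proof (cases "\<forall>x\<in>set X. x < k")
    case True
    have "defect (X @ stack_sort R) = 0"
      using True k assms R S
      by (subst defect_eq_0_iff_pos[of _ k]) (auto simp: order_less_le pos_append pos_Cons)
    then show ?thesis using True R by auto
  next
    case False
    define m where "m = Max (set X)"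
    have m: "m \<in> set X" "\<forall>x\<in>set X. x \<le> m"
      using False by (auto simp: m_def intro!: Max_in)
    have "k \<noteq> m" using m R assms by auto
    moreover obtain x where "x \<in> set X" "k \<le> x" using False by (auto simp: not_less)
    ultimately have km: "k < m" using m(2) by (simp add: order.strict_iff_order) (meson order_trans)
    have "m \<notin> set R" using m assms by auto
    then have "pos (X @ stack_sort R) m > 0"
      using assms R by (simp add: pos_append)
    moreover have "\<forall>x\<in>set R. x < m" using k km R by (auto intro: less_trans)
    moreover from this have "\<not> (\<exists>y\<in>set R. \<forall>x\<in>set X. x < y)" using m(1) by (meson less_asym)
    ultimately show ?thesis using m assms
      by (subst defect_eq_0_iff_pos[of _ m]) (auto simp: less_imp_le)
  qed
qed

lemma defect_snoc:
  assumes "distinct (L @ m # R @ [r])" "\<forall>x\<in>set L. x < m" "\<forall>x\<in>set R. x < r" "r < m"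
  shows "defect (L @ m # R @ [r]) = Suc (defect (stack_sort L @ stack_sort R))"
proof -
  have "stack_out (R @ [r]) = stack_sort R"
    using assms by (subst stack_out_split) auto
  then show ?thesis
    using assms by (subst defect_split) auto
qed

text \<open>\<open>m\<close> and \<open>r\<close> leave in the same pass, which gives the successor;
  \<open>R\<close> is written out in full when \<open>r\<close> arrives, and only \<open>Q\<close>
  can lose more letters.\<close>

lemma defect_two_maxima:
  assumes "distinct (L @ m # R @ r # Q)" "\<forall>x\<in>set L. x < m" "\<forall>x\<in>set R \<union> set Q. x < r" "r < m"
  shows "defect (L @ m # R @ r # Q) =
    Suc (length Q - length (stack_out Q) + defect (stack_sort L @ stack_sort R @ stack_out Q))"
proof -
  have "stack_out (R @ r # Q) = stack_sort R @ stack_out Q"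
    using assms by (intro stack_out_split) auto
  moreover have "length (stack_out Q) \<le> length Q"
    using length_stack_out_less[of Q] assms by (cases "Q = []") auto
  moreover have "\<forall>x\<in>set (R @ r # Q). x < m" using assms(3,4) by (auto intro: less_trans)
  ultimately show ?thesis
    using assms by (subst defect_split) auto
qed

text \<open>Defect 1 forces exactly two right-to-left maxima: w = L m1 A r, and S(L) S(A) must have
  defect 0. Either A is empty, so that \<open>m1\<close> is last but one, or the largest letter of L
  and A lies in A. The latter forces r = m2, since r exceeds A, and puts \<open>m3\<close> into A,
  that is, to the right of \<open>m1\<close>.\<close>

lemma defect_eq_1_iff_pos:
  assumes w: "distinct w" "m1 \<in> set w" "m2 \<in> set w" "m3 \<in> set w"
    and m: "m2 < m1" "m3 < m2" "\<forall>x\<in>set w. x = m1 \<or> x = m2 \<or> x \<le> m3"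
  shows "defect w = 1 \<longleftrightarrow> pos w m1 = 1 \<or> pos w m2 = 0 \<and> pos w m3 < pos w m1"
proof -
  obtain L R where LR: "w = L @ m1 # R" using w(2) by (meson split_list)
  have lt: "\<forall>x\<in>set L. x < m1" "\<forall>x\<in>set R. x < m1" using LR w(1) m by fastforce+
  have p1: "pos w m1 = length R" using LR w(1) by simp
  show ?thesis
  proof (cases "R = []")
    case True
    then have "defect w = 0" using LR lt w p1 by (subst defect_eq_0_iff_pos[of _ m1]) auto
    then show ?thesis using p1 True by simp
  next
    case False
    then obtain A r B where R: "R = A @ r # B" and r: "\<forall>x\<in>set A \<union> set B. x < r"
      using split_at_max w(1) LR by (metis distinct_append distinct.simps(2))
    have rm: "r < m1" using lt R by auto
    show ?thesis
    proof (cases "B = []")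
      case False
      have "defect w \<noteq> 1"
        using False LR R w(1) lt r rm length_stack_out_less[of B]
        by (simp add: defect_two_maxima)
      \<comment> \<open>The last letter of \<open>B\<close> is smaller than \<open>r\<close>, which
        in turn is smaller than \<open>m1\<close>, whereas no letter lies strictly between
        \<open>m2\<close> and \<open>m1\<close>.\<close>
      moreover have "pos w m2 \<noteq> 0"
      proof
        assume "pos w m2 = 0"
        moreover have "pos w (last B) = 0"
          using False LR R by (simp add: pos_append pos_Cons) (metis append_butlast_last_id pos_split empty_iff list.set(1) list.size(3))
        ultimately have "m2 = last B"
          using w(3) LR R False by (intro pos_inj[of m2 w]) auto
        then have "m2 < r" using r False by simp
        moreover have "r \<in> set w" using LR R by simp
        ultimately show False using rm m by fastforce
      qed
      moreover have "pos w m1 \<noteq> 1" using p1 R False by (cases B) auto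
      ultimately show ?thesis by simp
    next
      case True
      have w': "w = L @ m1 # A @ [r]" using LR R True by simp
      have "defect w = 1 \<longleftrightarrow> A = [] \<or> (\<exists>y\<in>set A. \<forall>x\<in>set L. x < y)"
        unfolding w' using w(1) lt r rm
        by (cases "A = []") (subst defect_snoc; auto simp: w' defect_append_stack_sort_eq_0_iff)+
      moreover have "A = [] \<longleftrightarrow> pos w m1 = 1" using p1 R True by simp
      moreover have "(\<exists>y\<in>set A. \<forall>x\<in>set L. x < y) \<longleftrightarrow> pos w m2 = 0 \<and> pos w m3 < pos w m1"
      proof
        assume "\<exists>y\<in>set A. \<forall>x\<in>set L. x < y"
        then obtain y where y: "y \<in> set A" "\<forall>x\<in>set L. x < y" by blast
        have "\<forall>x\<in>set A. x < r" "y < r" using r y by simp_all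
        then have "m2 \<in> set L \<union> set A \<Longrightarrow> m2 < r" using y(2) by (auto intro: less_trans)
        moreover have "r = m2 \<or> r \<le> m3" using m(3) w' rm by auto
        ultimately have "m2 = r" using w(3) m(1,2) w' by auto
        have "y \<le> m3" using y m(3) w(1) w' \<open>m2 = r\<close> by auto
        then have "m3 \<in> set A" using w(4) y m(1,2) \<open>m2 = r\<close> w' by auto
        then show "pos w m2 = 0 \<and> pos w m3 < pos w m1"
          using w(1) \<open>m2 = r\<close> by (auto simp: w' pos_append pos_Cons dest: pos_less_length)
      next
        assume *: "pos w m2 = 0 \<and> pos w m3 < pos w m1"
        have "pos w r = 0" using w' by (simp add: pos_append pos_Cons)
        then have "m2 = r" using * w(3) w' by (intro pos_inj[of m2 w]) auto
        moreover have "m3 \<notin> set L"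
        proof
          assume "m3 \<in> set L"
          then have "pos w m3 \<ge> length R" using w(1) LR by (auto simp: pos_append)
          then show False using * p1 by simp
        qed
        ultimately have "m3 \<in> set A" using w(4) w' m by auto
        moreover have "x < m3" if "x \<in> set L" for x
          using that m w(1) w' \<open>m2 = r\<close> \<open>m3 \<notin> set L\<close> by (auto simp: order_less_le)
        ultimately show "\<exists>y\<in>set A. \<forall>x\<in>set L. x < y" by blast
      qed
      ultimately show ?thesis by blast
    qed
  qed
qed

text \<open>The right-to-left maxima of the joint word are \<open>k\<close> and \<open>r\<close>,
  and one pass removes both at the cost of defect 1. What remains is again a word followed by an
  output of S, so the criterion for defect 0 applies to \<open>L\<close> without \<open>k\<close>
  and \<open>R\<close> without \<open>r\<close>, unless \<open>R\<close> was just
  \<open>r\<close>.\<close>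

lemma defect_append_stack_sort_eq_1_iff:
  assumes "distinct (L @ R)" "r \<in> set R" "\<forall>x\<in>set R. x \<le> r" "k \<in> set L" "\<forall>x\<in>set L. x \<le> k" "r < k"
  shows "defect (stack_sort L @ stack_sort R) = 1 \<longleftrightarrow>
    length R = 1 \<or> (\<exists>y\<in>set R - {r}. \<forall>x\<in>set L - {k}. x < y)"
proof -
  obtain A B where L: "L = A @ k # B" using assms(4) by (meson split_list)
  obtain C D where R: "R = C @ r # D" using assms(2) by (meson split_list)
  have lt: "\<forall>x\<in>set A \<union> set B. x < k" "\<forall>x\<in>set C \<union> set D. x < r"
    using assms L R by (auto simp: order_less_le)
  have S: "stack_sort L @ stack_sort R
      = (stack_sort A @ stack_sort B) @ k # (stack_sort C @ stack_sort D) @ [r]"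
    using lt by (simp add: L R stack_sort_split)
  have d: "defect (stack_sort L @ stack_sort R) = Suc (defect (stack_sort (stack_sort A @ stack_sort B)
      @ stack_sort (stack_sort C @ stack_sort D)))"
    unfolding S using assms L R lt by (intro defect_snoc) auto
  have sets: "set L - {k} = set A \<union> set B" "set R - {r} = set C \<union> set D"
    using assms(1) L R by auto
  have len: "length R = 1 \<longleftrightarrow> stack_sort C @ stack_sort D = []"
    using assms(1) R by simp
  have dist: "distinct A" "distinct B" "distinct C" "distinct D"
    using assms(1) L R by simp_all
  have disj: "(set A \<union> set B) \<inter> (set C \<union> set D) = {}"
    using assms(1) L R by auto
  have AB: "distinct (stack_sort A @ stack_sort B)" and CD: "distinct (stack_sort C @ stack_sort D)"
    using assms(1) L R by auto
  have iff: "defect (stack_sort (stack_sort A @ stack_sort B) @ stack_sort (stack_sort C @ stack_sort D)) = 0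
      \<longleftrightarrow> (\<exists>y\<in>set R - {r}. \<forall>x\<in>set L - {k}. x < y)"
    if "stack_sort C @ stack_sort D \<noteq> []"
  proof (subst defect_append_stack_sort_eq_0_iff)
    show "distinct (stack_sort (stack_sort A @ stack_sort B) @ stack_sort C @ stack_sort D)"
      using CD dist disj unfolding distinct_append[of "stack_sort _"] set_stack_sort[OF AB]
      by (auto simp del: distinct_append intro: distinct_stack_sort AB)
  qed (use that AB dist in \<open>simp_all add: sets set_stack_sort[OF AB] del: distinct_append\<close>)
  show ?thesis
  proof (cases "stack_sort C @ stack_sort D = []")
    case True
    then have "defect (stack_sort (stack_sort A @ stack_sort B) @ stack_sort (stack_sort C @ stack_sort D)) = 0"
      using defect_stack_sort[OF AB] by (metis append.right_neutral stack_sort_Nil)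
    then have "defect (stack_sort L @ stack_sort R) = 1" unfolding d by (simp only: One_nat_def)
    moreover have "length R = 1" using len True by blast
    ultimately show ?thesis by blast
  next
    case False
    then show ?thesis using d len iff[OF False] by (metis One_nat_def Suc_inject)
  qed
qed

section \<open>Words of defect two\<close>

definition top_letters :: "nat list \<Rightarrow> nat \<Rightarrow> nat \<Rightarrow> nat \<Rightarrow> nat \<Rightarrow> nat \<Rightarrow> bool" where
  "top_letters w m1 m2 m3 m4 m5 \<longleftrightarrow> {m1, m2, m3, m4, m5} \<subseteq> set w
    \<and> m2 < m1 \<and> m3 < m2 \<and> m4 < m3 \<and> m5 < m4
    \<and> (\<forall>x\<in>set w. x = m1 \<or> x = m2 \<or> x = m3 \<or> x = m4 \<or> x \<le> m5)"

text \<open>In the first disjunct two letters follow \<open>m1\<close>; the exception, a word ending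
  in m1 m3 m2, has defect 1. The next three describe words L m1 A r C q with three right-to-left
  maxima: \<open>m4\<close> in A or in C when r q = m2 m3, or r = m2, C empty and \<open>m3\<close>
  in A. The last two describe words L m1 A r with two, where r is \<open>m3\<close> or
  \<open>m2\<close>, the other one lies in L, and \<open>m4\<close>, \<open>m5\<close> lie in A. The
  positions are given by a function so that shifted ones can be inserted in
  \<open>lag_2_shape\<close>.\<close>

definition defect_2_shape :: "(nat \<Rightarrow> nat) \<Rightarrow> nat \<Rightarrow> nat \<Rightarrow> nat \<Rightarrow> nat \<Rightarrow> nat \<Rightarrow> bool" where
  "defect_2_shape p m1 m2 m3 m4 m5 \<longleftrightarrow>
     p m1 = 2 \<and> \<not> (p m2 = 0 \<and> p m3 = 1)
   \<or> p m3 = 0 \<and> p m2 = 1 \<and> p m4 < p m1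
   \<or> p m3 = 0 \<and> p m4 < p m2 \<and> p m2 < p m1
   \<or> p m2 = 1 \<and> 1 < p m3 \<and> p m3 < p m1
   \<or> p m3 = 0 \<and> p m4 < p m1 \<and> p m5 < p m1 \<and> p m1 < p m2
   \<or> p m2 = 0 \<and> p m4 < p m1 \<and> p m5 < p m1 \<and> p m1 < p m3"

text \<open>The letters \<open>m1\<close>, \<open>r\<close>, \<open>q\<close> leave in the first
  pass and already account for defect 2, so S(L) S(A) S(C) must have defect 0. This means that the
  last nonempty block contains the largest of the remaining letters.\<close>

lemma defect_eq_2_three_maxima:
  assumes w: "w = L @ m1 # A @ r # C @ [q]" "distinct w"
    and lt: "\<forall>x\<in>set C. x < q" "\<forall>x\<in>set A. x < r" "q < r" "r < m1" "\<forall>x\<in>set L. x < m1"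
    and top: "top_letters w m1 m2 m3 m4 m5"
  shows "defect w = 2 \<longleftrightarrow> defect_2_shape (pos w) m1 m2 m3 m4 m5"
proof -
  have Cr: "\<forall>x\<in>set C. x < r" using lt by auto
  have out: "stack_out (C @ [q]) = stack_sort C"
    using w lt by (subst stack_out_split) auto
  have "defect w = Suc (Suc (defect (stack_sort L @ stack_sort A @ stack_sort C)))"
    using w lt Cr out unfolding w(1) by (subst defect_two_maxima) auto
  then have d: "defect w = 2 \<longleftrightarrow> defect ((stack_sort L @ stack_sort A) @ stack_sort C) = 0"
    by simp
  have pq: "pos w q = 0" and pr: "pos w r = Suc (length C)" and p1: "pos w m1 = length A + length C + 2"
    using w by (auto simp: pos_append pos_Cons)
  have pC: "0 < pos w x \<and> pos w x < pos w r" if "x \<in> set C" for x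
    using that w by (auto simp: pos_append pos_Cons dest: pos_less_length)
  have pA: "pos w r < pos w x \<and> pos w x < pos w m1" if "x \<in> set A" for x
    using that w by (auto simp: pos_append pos_Cons dest: pos_less_length)
  have pL: "pos w m1 < pos w x" if "x \<in> set L" for x
    using that w by (auto simp: pos_append pos_Cons)
  have m: "m2 < m1" "m3 < m2" "m4 < m3" "m5 < m4"
    using top by (auto simp: top_letters_def)
  have le: "x = m1 \<or> x = m2 \<or> x = m3 \<or> x = m4 \<or> x \<le> m5" if "x \<in> set w" for x
    using top that by (auto simp: top_letters_def)
  have mem: "x \<in> set L \<or> x = m1 \<or> x \<in> set A \<or> x = r \<or> x \<in> set C \<or> x = q" if "x \<in> {m2, m3, m4, m5}" for x
    using top that w by (auto simp: top_letters_def)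
  have inw: "q \<in> set w" "r \<in> set w" using w by auto
  have m1_notin: "m1 \<notin> set L" "m1 \<notin> set A" "m1 \<notin> set C"
    and q_notin: "q \<notin> set L" "q \<notin> set A" and r_notin: "r \<notin> set L" "r \<notin> set A" using w by auto
  have A_le: "x \<le> m3" if "x \<in> set A" "r = m2" for x
    using that lt le[of x] m w(1) by fastforce
  have r_cases: "r = m2 \<or> r \<le> m3" using le[OF inw(2)] lt(4) m by auto
  have q_cases: "q = m3 \<or> q \<le> m4" using le[OF inw(1)] lt(3,4) r_cases m by auto
  have C_le: "x \<le> m4" if "x \<in> set C" for x
  proof -
    have "x < m3" using that lt(1) q_cases m by fastforce
    then show ?thesis using le[of x] that w(1) m by auto
  qed
  have m_in: "m2 \<in> set w" "m3 \<in> set w" "m4 \<in> set w" "m5 \<in> set w"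
    using top by (auto simp: top_letters_def)
  have m_notin_C: "m2 \<notin> set C" "m3 \<notin> set C" "m2 \<noteq> q" using C_le q_cases m by fastforce+
  have q_m3: "q = m3" if "pos w m3 = 0" using pos_inj that pq inw(1) m_in(2) by metis
  have r_m2: "r = m2" if "pos w m3 = 0" using q_m3[OF that] r_cases lt(3) by simp
  have p2: "0 < pos w m2" "pos w m2 < pos w m1 \<Longrightarrow> pos w r \<le> pos w m2"
    using pos_inj[of m2 w q] m_in inw pq m_notin_C mem[of m2] pA[of m2] pL[of m2] m by auto
  have m4_C: "m4 \<in> set C" if "pos w m3 = 0" "pos w m4 < pos w m2"
    using that q_m3 r_m2 mem[of m4] pA[of m4] pL[of m4] m p1 pr by fastforce
  show ?thesis
  proof (cases "C = []")
    case False
    have "defect w = 2 \<longleftrightarrow> (\<exists>y\<in>set C. \<forall>x\<in>set L \<union> set A. x < y)"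
      using d w False by (subst (asm) defect_append_stack_sort_eq_0_iff) auto
    also have "\<dots> \<longleftrightarrow> pos w m3 = 0 \<and> pos w m4 < pos w m2 \<and> pos w m2 < pos w m1"
    proof
      assume "\<exists>y\<in>set C. \<forall>x\<in>set L \<union> set A. x < y"
      then obtain y where y: "y \<in> set C" "\<forall>x\<in>set L \<union> set A. x < y" by blast
      then have "x < m4" if "x \<in> set L \<union> set A" for x
        using C_le[OF y(1)] y(2) that by (meson less_le_trans)
      from this[of m2] this[of m3] this[of m4]
      have *: "m2 \<notin> set L \<union> set A" "m3 \<notin> set L \<union> set A" "m4 \<notin> set L \<union> set A"
        using m by auto
      then have "r = m2" using mem[of m2] m m_notin_C by auto
      moreover from this have "q = m3" using mem[of m3] m m_notin_C * by auto
      ultimately show "pos w m3 = 0 \<and> pos w m4 < pos w m2 \<and> pos w m2 < pos w m1"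
        using mem[of m4] m * pq pr p1 pC[of m4] by auto
    next
      assume *: "pos w m3 = 0 \<and> pos w m4 < pos w m2 \<and> pos w m2 < pos w m1"
      have "x < m4" if "x \<in> set L \<union> set A" for x
      proof -
        have "x \<noteq> m4" using that m4_C * w by auto
        moreover have "x \<noteq> m1" "x \<noteq> m2" "x \<noteq> m3"
          using that m1_notin q_notin r_notin q_m3 r_m2 * by auto
        ultimately show ?thesis using that le[of x] m w(1) by auto
      qed
      then show "\<exists>y\<in>set C. \<forall>x\<in>set L \<union> set A. x < y" using * m4_C by blast
    qed
    \<comment> \<open>As \<open>C\<close> is nonempty, \<open>r\<close> has position at least 2 and
      \<open>m1\<close> at least 3. A letter \<open>m2\<close> to the right of \<open>m1\<close> is
      then at position 2 or beyond, and \<open>m3\<close> can be last only if r = m2. This leaves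
      the third disjunct alone.\<close>
    also have "\<dots> \<longleftrightarrow> defect_2_shape (pos w) m1 m2 m3 m4 m5"
      using p1 pr p2 r_m2 False unfolding defect_2_shape_def by auto
    finally show ?thesis .
  next
    case C: True
    show ?thesis
    proof (cases "A = []")
      case True
      have "defect w = 2" using d C True w by simp
      moreover have "pos w m1 = 2" "pos w m2 \<noteq> 0" using p1 p2 True C by auto
      ultimately show ?thesis by (simp add: defect_2_shape_def)
    next
      case A: False
      have "defect w = 2 \<longleftrightarrow> (\<exists>y\<in>set A. \<forall>x\<in>set L. x < y)"
        using d w A C by (simp add: defect_append_stack_sort_eq_0_iff)
      also have "\<dots> \<longleftrightarrow> defect_2_shape (pos w) m1 m2 m3 m4 m5"
      proof
        assume "\<exists>y\<in>set A. \<forall>x\<in>set L. x < y"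
        then obtain y where y: "y \<in> set A" "\<forall>x\<in>set L. x < y" by blast
        have "m2 \<notin> set L \<union> set A" using y lt(2) r_cases m by fastforce
        then have r: "r = m2" using mem[of m2] m m_notin_C by auto
        then have "m3 \<notin> set L" using y A_le[of y] by fastforce
        then consider "m3 \<in> set A" | "m3 = q" using mem[of m3] m m_notin_C r by auto
        then show "defect_2_shape (pos w) m1 m2 m3 m4 m5"
        proof cases
          case 1
          then show ?thesis using r pA[of m3] pr C by (simp add: defect_2_shape_def)
        next
          case 2
          have "y \<le> m4" using A_le[of y] r y 2 q_notin le[of y] w m by auto
          then have "m4 \<notin> set L" using y by fastforce
          then have "m4 \<in> set A" using mem[of m4] m 2 r C by auto
          then show ?thesis using r pA[of m4] pr C pq 2 by (simp add: defect_2_shape_def)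
        qed
      next
        assume shape: "defect_2_shape (pos w) m1 m2 m3 m4 m5"
        have "2 < pos w m1" using p1 A by (cases A) auto
        with shape p2(1) consider
            (B) "pos w m3 = 0" "pos w m2 = 1" "pos w m4 < pos w m1"
          | (E) "pos w m2 = 1" "1 < pos w m3" "pos w m3 < pos w m1"
          | (C) "pos w m3 = 0" "pos w m4 < pos w m2" "pos w m2 < pos w m1"
          | (D) "pos w m3 = 0" "pos w m1 < pos w m2"
          unfolding defect_2_shape_def by (elim disjE) auto
        then show "\<exists>y\<in>set A. \<forall>x\<in>set L. x < y"
        proof cases
          case B
          then have "q = m3" "r = m2" using q_m3 r_m2 by auto
          then have "m4 \<in> set A" using mem[of m4] pL[of m4] m \<open>C = []\<close> B(3) by auto
          moreover have "x < m4" if "x \<in> set L" for x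
          proof -
            have "x \<noteq> m4" using that calculation w by auto
            moreover have "x \<noteq> m1" "x \<noteq> m2" "x \<noteq> m3"
              using that m1_notin q_notin r_notin \<open>q = m3\<close> \<open>r = m2\<close> by auto
            ultimately show ?thesis using that le[of x] m w(1) by auto
          qed
          ultimately show ?thesis by blast
        next
          case E
          then have r: "r = m2" using pos_inj[of m2 w r] m_in inw pr C by simp
          have "m3 \<in> set A" using mem[of m3] pL[of m3] E(2,3) r pq m \<open>C = []\<close> by auto
          moreover have "x < m3" if "x \<in> set L" for x
          proof -
            have "x \<noteq> m3" using that calculation w by auto
            moreover have "x \<noteq> m1" "x \<noteq> m2" using that m1_notin r_notin r by auto
            ultimately show ?thesis using that le[of x] m w(1) by auto
          qed
          ultimately show ?thesis by blast
        next
          case C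
          then show ?thesis using m4_C \<open>C = []\<close> by simp
        next
          case D
          then show ?thesis using r_m2 p1 pr by simp
        qed
      qed
      finally show ?thesis .
    qed
  qed
qed

text \<open>\<open>m1\<close> and \<open>r\<close> leave in the first pass and account for defect 1,
  so S(L) S(A) must have defect exactly 1. Hence its maximum must not lie in A, and the
  second-largest letters of L and A have to be compared, unless A is a single letter.\<close>

lemma defect_eq_2_two_maxima:
  assumes w: "w = L @ m1 # A @ [r]" "distinct w"
    and lt: "\<forall>x\<in>set A. x < r" "r < m1" "\<forall>x\<in>set L. x < m1"
    and top: "top_letters w m1 m2 m3 m4 m5"
  shows "defect w = 2 \<longleftrightarrow> defect_2_shape (pos w) m1 m2 m3 m4 m5"
proof -
  have d: "defect w = 2 \<longleftrightarrow> defect (stack_sort L @ stack_sort A) = 1"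
    using w lt unfolding w(1) by (subst defect_snoc) auto
  have pr: "pos w r = 0" and p1: "pos w m1 = length A + 1"
    using w by (auto simp: pos_append pos_Cons)
  have pA: "0 < pos w x \<and> pos w x < pos w m1" if "x \<in> set A" for x
    using that w by (auto simp: pos_append pos_Cons dest: pos_less_length)
  have pL: "pos w m1 < pos w x" if "x \<in> set L" for x
    using that w by (auto simp: pos_append pos_Cons)
  have m: "m2 < m1" "m3 < m2" "m4 < m3" "m5 < m4"
    using top by (auto simp: top_letters_def)
  have le: "x = m1 \<or> x = m2 \<or> x = m3 \<or> x = m4 \<or> x \<le> m5" if "x \<in> set w" for x
    using top that by (auto simp: top_letters_def)
  have mem: "x \<in> set L \<or> x \<in> set A \<or> x = r" if "x \<in> {m2, m3, m4, m5}" for x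
    using top that w m by (auto simp: top_letters_def)
  have m_in: "m2 \<in> set w" "m3 \<in> set w" "m4 \<in> set w" "m5 \<in> set w" and r_in: "r \<in> set w"
    using top w(1) by (auto simp: top_letters_def)
  have notin: "m1 \<notin> set L" "m1 \<notin> set A" "r \<notin> set L" "r \<notin> set A" using w by auto
  have r_eq: "r = x" if "pos w x = 0" "x \<in> set w" for x using pos_inj that pr r_in by metis
  have pos_neq: "pos w m3 \<noteq> pos w m4" "pos w m2 \<noteq> pos w m4"
    using pos_inj[of m3 w m4] pos_inj[of m2 w m4] m_in m by auto
  show ?thesis
  proof (cases "\<exists>y\<in>set A. \<forall>x\<in>set L. x < y")
    case True
    then have "defect (stack_sort L @ stack_sort A) = 0"
      using w by (subst defect_append_stack_sort_eq_0_iff) auto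
    then have "defect w \<noteq> 2" using d by simp
    obtain y where y: "y \<in> set A" "\<forall>x\<in>set L. x < y" using True by blast
    have "r = m2 \<or> r \<le> m3" using le[OF r_in] lt(2) m by auto
    then have "m2 \<notin> set L \<union> set A" using y lt(1) m by fastforce
    then have r: "r = m2" using mem[of m2] by auto
    then have "y \<le> m3" using y lt le[of y] m w by fastforce
    then have "m3 \<notin> set L" using y by fastforce
    then have "m3 \<in> set A" using mem[of m3] r m by auto
    then have "0 < pos w m3" "pos w m3 < pos w m1" using pA by auto
    then have "\<not> defect_2_shape (pos w) m1 m2 m3 m4 m5"
      using r pr unfolding defect_2_shape_def by auto
    then show ?thesis using \<open>defect w \<noteq> 2\<close> by blast
  next
    case notP: False
    show ?thesis
    proof (cases "A = []")
      case True
      then have "defect w \<noteq> 2" using d w by simp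
      moreover have "\<not> defect_2_shape (pos w) m1 m2 m3 m4 m5"
        using p1 True pos_neq unfolding defect_2_shape_def by auto
      ultimately show ?thesis by blast
    next
      case A: False
      define a where "a = Max (set A)"
      define k where "k = Max (set L)"
      have a: "a \<in> set A" "\<forall>x\<in>set A. x \<le> a" using A by (auto simp: a_def intro!: Max_in)
      have "L \<noteq> []" using notP A a(1) by auto
      then have k: "k \<in> set L" "\<forall>x\<in>set L. x \<le> k" by (auto simp: k_def intro!: Max_in)
      have "a \<noteq> k" using a k w by auto
      moreover have "\<not> k < a" using notP a k by (meson le_less_trans)
      ultimately have ak: "a < k" by simp
      have ar: "a < r" using a lt by simp
      have "defect w = 2 \<longleftrightarrow> length A = 1 \<or> (\<exists>y\<in>set A - {a}. \<forall>x\<in>set L - {k}. x < y)"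
        unfolding d using w a k ak by (intro defect_append_stack_sort_eq_1_iff) auto
      also have "\<dots> \<longleftrightarrow> defect_2_shape (pos w) m1 m2 m3 m4 m5"
      proof (cases "length A = 1")
        case True
        \<comment> \<open>The exception of the first disjunct would make \<open>m3\<close> the only
          letter of \<open>A\<close> and \<open>m2\<close> the last letter, so that \<open>A\<close>
          would hold the largest letter of \<open>L\<close> and \<open>A\<close>.\<close>
        have "\<not> (pos w m2 = 0 \<and> pos w m3 = 1)"
        proof
          assume *: "pos w m2 = 0 \<and> pos w m3 = 1"
          then have "r = m2" using r_eq m_in by blast
          moreover have "m3 \<in> set A" using * mem[of m3] pL[of m3] p1 True m calculation by fastforce
          moreover have "k \<le> m3" using k(1) notin le[of k] w m calculation by auto
          ultimately show False using a ak by (meson leD le_less_trans less_le_trans)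
        qed
        then show ?thesis using True p1 by (simp add: defect_2_shape_def)
      next
        case len: False
        then have p1': "2 < pos w m1" using p1 A by (cases A) auto
        show ?thesis
        proof
          assume "length A = 1 \<or> (\<exists>y\<in>set A - {a}. \<forall>x\<in>set L - {k}. x < y)"
          then obtain y where y: "y \<in> set A" "y \<noteq> a" "\<forall>x\<in>set L - {k}. x < y" using len by auto
          have ya: "y < a" using y a by (simp add: order_less_le)
          consider "r = m2" | "r = m3" | "r \<le> m4" using le[OF r_in] lt(2) m by fastforce
          then show "defect_2_shape (pos w) m1 m2 m3 m4 m5"
          proof cases
            case 1
            have "k \<le> m3" using k(1) notin le[of k] w m 1 by auto
            then have "m3 \<notin> set A" using a(2) ak by fastforce
            then have "m3 \<in> set L" using mem[of m3] 1 m by auto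
            then have km3: "k = m3" using \<open>k \<le> m3\<close> k by (simp add: order_antisym)
            have "a \<le> m4" using le[of a] a(1) w ak km3 m by auto
            then have "y \<le> m5" using le[of y] y(1) w ya m by auto
            then have "x < m5" if "x \<in> set L - {k}" for x
              using that y(3) by (meson less_le_trans)
            from this[of m4] this[of m5] have "m4 \<notin> set L" "m5 \<notin> set L" using km3 m by auto
            then have "m4 \<in> set A" "m5 \<in> set A" using mem[of m4] mem[of m5] 1 m by auto
            then show ?thesis using 1 pr pA pL[OF \<open>m3 \<in> set L\<close>] by (simp add: defect_2_shape_def)
          next
            case 2
            have "m2 \<notin> set A" using lt(1) 2 m by fastforce
            then have "m2 \<in> set L" using mem[of m2] 2 m by auto
            have "k \<le> m2" using k(1) notin le[of k] w m by auto
            then have km2: "k = m2" using \<open>m2 \<in> set L\<close> k by (simp add: order_antisym)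
            have "a \<le> m4" using le[of a] a(1) w ar 2 m by auto
            then have "y \<le> m5" using le[of y] y(1) w ya m by auto
            then have "x < m5" if "x \<in> set L - {k}" for x
              using that y(3) by (meson less_le_trans)
            from this[of m4] this[of m5] have "m4 \<notin> set L" "m5 \<notin> set L" using km2 m by auto
            then have "m4 \<in> set A" "m5 \<in> set A" using mem[of m4] mem[of m5] 2 m by auto
            then show ?thesis using 2 pr pA pL[OF \<open>m2 \<in> set L\<close>] by (simp add: defect_2_shape_def)
          next
            \<comment> \<open>This case is impossible: \<open>m2\<close> and \<open>m3\<close> both
              lie in \<open>L\<close>, so even without \<open>k\<close> there remains a letter of
              \<open>L\<close> that exceeds all of \<open>A\<close>.\<close>
            case 3
            then have "m2 \<notin> set A" "m3 \<notin> set A" using lt(1) m by fastforce+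
            then have "m2 \<in> set L" "m3 \<in> set L" using mem[of m2] mem[of m3] 3 m by auto
            then have "m2 \<le> k" using k by blast
            then have "m3 \<in> set L - {k}" using \<open>m3 \<in> set L\<close> m by auto
            then have "m3 < y" using y by blast
            then show ?thesis using ya ar 3 m by simp
          qed
        next
          assume "defect_2_shape (pos w) m1 m2 m3 m4 m5"
          moreover have "pos w m2 \<noteq> 1" if "pos w m3 = 0"
            using that r_eq m_in mem[of m2] pL[of m2] p1' lt m by fastforce
          moreover have "\<not> pos w m2 < pos w m1" if "pos w m3 = 0"
            using that r_eq m_in mem[of m2] pL[of m2] p1' lt m by fastforce
          moreover have "pos w m2 \<noteq> 1"
            using mem[of m2] pL[of m2] p1' lt le[OF r_in] m pr by fastforce
          ultimately consider
              (D) "pos w m3 = 0" "pos w m4 < pos w m1" "pos w m5 < pos w m1" "pos w m1 < pos w m2"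
            | (H) "pos w m2 = 0" "pos w m4 < pos w m1" "pos w m5 < pos w m1" "pos w m1 < pos w m3"
            using p1' unfolding defect_2_shape_def by (elim disjE) auto
          then have "m4 \<in> set A \<and> m5 \<in> set A \<and> (\<forall>x\<in>set L - {k}. x < m5)"
          proof cases
            case D
            have r: "r = m3" using D r_eq m_in by blast
            then have A: "m4 \<in> set A" "m5 \<in> set A"
              using D mem[of m4] mem[of m5] pL[of m4] pL[of m5] m by auto
            have "m2 \<in> set L" using D mem[of m2] r m pA[of m2] by auto
            moreover have "k \<le> m2" using k(1) notin le[of k] w m by auto
            ultimately have "k = m2" using k by (simp add: order_antisym)
            then have "x < m5" if "x \<in> set L - {k}" for x
              using that le[of x] A r notin w by (auto simp: order_less_le)
            then show ?thesis using A by blast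
          next
            case H
            have r: "r = m2" using H r_eq m_in by blast
            then have A: "m4 \<in> set A" "m5 \<in> set A"
              using H mem[of m4] mem[of m5] pL[of m4] pL[of m5] m by auto
            have "m3 \<in> set L" using H mem[of m3] r m pA[of m3] by auto
            moreover have "k \<le> m3" using k(1) notin le[of k] w m r by auto
            ultimately have "k = m3" using k by (simp add: order_antisym)
            then have "x < m5" if "x \<in> set L - {k}" for x
              using that le[of x] A r notin w by (auto simp: order_less_le)
            then show ?thesis using A by blast
          qed
          moreover from this have "m5 \<noteq> a" using a m by fastforce
          ultimately show "length A = 1 \<or> (\<exists>y\<in>set A - {a}. \<forall>x\<in>set L - {k}. x < y)" by blast
        qed
      qed
      finally show ?thesis .
    qed
  qed
qed

text \<open>The number of right-to-left maxima decides. A single one means defect 0, two or three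
  are treated above, and with four or more the first pass alone contributes at least 3 to the
  defect.\<close>

lemma defect_eq_2_iff_pos:
  assumes w: "distinct w" and top: "top_letters w m1 m2 m3 m4 m5"
  shows "defect w = 2 \<longleftrightarrow> defect_2_shape (pos w) m1 m2 m3 m4 m5"
proof -
  have m: "m2 < m1" "m3 < m2" "m4 < m3" "m5 < m4"
    using top by (auto simp: top_letters_def)
  have le: "x = m1 \<or> x = m2 \<or> x = m3 \<or> x = m4 \<or> x \<le> m5" if "x \<in> set w" for x
    using top that by (auto simp: top_letters_def)
  have m_in: "m1 \<in> set w" "m2 \<in> set w" "m3 \<in> set w"
    using top by (auto simp: top_letters_def)
  obtain L R where LR: "w = L @ m1 # R" using m_in(1) by (meson split_list)
  have lt: "\<forall>x\<in>set L. x < m1" "\<forall>x\<in>set R. x < m1"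
    using LR w le m by fastforce+
  have p1: "pos w m1 = length R" using LR w by simp
  show ?thesis
  proof (cases "R = []")
    case True
    then have "defect w = 0"
      using lt p1 w m_in by (subst defect_eq_0_iff_pos[of _ m1]) (auto simp: LR less_imp_le)
    then show ?thesis using p1 True by (simp add: defect_2_shape_def)
  next
    case False
    then obtain A r B where R: "R = A @ r # B" and r: "\<forall>x\<in>set A \<union> set B. x < r"
      using split_at_max w LR by (metis distinct_append distinct.simps(2))
    have rm: "r < m1" using lt R by simp
    show ?thesis
    proof (cases "B = []")
      case True
      then show ?thesis
        using LR R r rm lt w top by (intro defect_eq_2_two_maxima) auto
    next
      case False
      then obtain C q D where B: "B = C @ q # D" and q: "\<forall>x\<in>set C \<union> set D. x < q"
        using split_at_max w LR R by (metis distinct_append distinct.simps(2))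
      have qr: "q < r" using r B by simp
      show ?thesis
      proof (cases "D = []")
        case True
        then show ?thesis
          using LR R B r q qr rm lt w top
          by (intro defect_eq_2_three_maxima[of w L m1 A r C q]) auto
      next
        case False
        have out: "stack_out B = stack_sort C @ stack_out D"
          using w LR R q unfolding B by (intro stack_out_split) auto
        have "length (stack_out D) < length D"
          using length_stack_out_less False w LR R B by simp
        moreover have "length (stack_sort C) = length C"
          using w LR R B by simp
        moreover have "defect w = Suc (length B - length (stack_out B)
            + defect (stack_sort L @ stack_sort A @ stack_out B))"
          using w lt r rm unfolding LR R by (intro defect_two_maxima) auto
        ultimately have "defect w \<noteq> 2" using B out by simp
        \<comment> \<open>The letters of \<open>D\<close> lie below q, r and \<open>m1\<close>, so
          at least three letters exceed each of them, and at least two exceed \<open>q\<close>.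
          Consequently \<open>m3\<close> is not last, \<open>m2\<close> has position at least 2 and
          \<open>m1\<close> at least 3, which contradicts every disjunct.\<close>
        have notin: "m2 \<notin> set (q # D)" "m3 \<notin> set D"
        proof -
          have D: "\<forall>x\<in>set D. x < q" using q by simp
          have "r = m2 \<or> r \<le> m3" using le[of r] rm m LR R by auto
          moreover have "q = m3 \<or> q \<le> m4" using le[of q] qr rm calculation m LR R B by auto
          ultimately show "m2 \<notin> set (q # D)" "m3 \<notin> set D" using D qr m by fastforce+
        qed
        have "w = (L @ m1 # A @ r # C @ [q]) @ D" by (simp add: LR R B)
        then have "pos w m3 \<ge> length D" using notin(2) by (simp only: pos_append) simp
        moreover have "w = (L @ m1 # A @ r # C) @ q # D" by (simp add: LR R B)
        then have "pos w m2 > length D" using notin(1) by (simp only: pos_append) simp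
        moreover have "0 < length D" using False by simp
        moreover have "pos w m1 > 2" using p1 R B False by (cases D) auto
        ultimately have "\<not> defect_2_shape (pos w) m1 m2 m3 m4 m5"
          unfolding defect_2_shape_def by auto
        then show ?thesis using \<open>defect w \<noteq> 2\<close> by blast
      qed
    qed
  qed
qed

section \<open>Complexity in terms of positions\<close>

text \<open>The number by which \<^term>\<open>passes (greater_before a w)\<close> falls short of the number of letters
  greater than \<open>a\<close>.\<close>

definition lag :: "nat \<Rightarrow> nat list \<Rightarrow> nat" where
  "lag a w = pos w a + defect (greater_before a w)"

text \<open>\<open>p a\<close> is the number of letters after \<open>a\<close>, so the word before
  \<open>a\<close> must have defect 1 - p a, and positions in that word are smaller by p a + 1. In
  the last alternative \<open>n\<close> stands after \<open>a\<close>, and \<open>n - 1\<close>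
  takes over as the maximum of the word before it.\<close>

definition lag_1_shape :: "(nat \<Rightarrow> nat) \<Rightarrow> nat \<Rightarrow> nat \<Rightarrow> bool" where
  "lag_1_shape p a n \<longleftrightarrow>
     p a = 0 \<and> (p n = 2 \<or> p (n - 1) = 1 \<and> p (n - 2) < p n)
   \<or> p a = 1 \<and> (p n = 2 \<or> p n = 0 \<and> p (n - 1) = 2)"

text \<open>The values 0, 1, 2 of \<open>p a\<close> leave defect 2, 1, 0 for the word before
  \<open>a\<close>. For \<open>p a = 1\<close> the nested conditional asks which of
  \<open>n\<close>, \<open>n - 1\<close>, \<open>n - 2\<close>, if any, is the letter after
  \<open>a\<close>, because the criterion for defect 1 refers to the three largest of the remaining
  letters. For \<open>p a = 2\<close> the largest letter outside the last two positions must stand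
  directly before \<open>a\<close>.\<close>

definition lag_2_shape :: "(nat \<Rightarrow> nat) \<Rightarrow> nat \<Rightarrow> nat \<Rightarrow> bool" where
  "lag_2_shape p a n \<longleftrightarrow>
     p a = 0 \<and> defect_2_shape (\<lambda>x. p x - 1) n (n - 1) (n - 2) (n - 3) (n - 4)
   \<or> p a = 1 \<and>
      (if p n = 0 then p (n - 1) = 3 \<or> p (n - 2) = 2 \<and> p (n - 3) < p (n - 1)
       else if p (n - 1) = 0 then p n = 3 \<or> p (n - 2) = 2 \<and> p (n - 3) < p n
       else if p (n - 2) = 0 then p n = 3 \<or> p (n - 1) = 2 \<and> p (n - 3) < p n
       else p n = 3 \<or> p (n - 1) = 2 \<and> p (n - 2) < p n)
   \<or> p a = 2 \<and> (p n = 3 \<or> p n < 2 \<and> (p (n - 1) = 3 \<or> p (n - 1) < 2 \<and> p (n - 2) = 3))"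

lemma greater_before_split:
  assumes w: "distinct w" "set w = {a..n}" and an: "a \<le> n"
  obtains P Q where "w = P @ a # Q" "greater_before a w = P" "pos w a = length Q"
    "distinct P" "distinct Q" "set P \<union> set Q = {a<..n}" "set P \<inter> set Q = {}"
    "\<forall>x\<in>set P. pos w x = Suc (length Q + pos P x)" "\<forall>x\<in>set Q. pos w x < length Q"
proof -
  have "a \<in> set w" using w an by simp
  then obtain P Q where PQ: "w = P @ a # Q" by (meson split_list)
  have *: "set P \<union> set Q = {a<..n}"
  proof -
    have "set P \<union> set Q = set w - {a}" using PQ w by auto
    also have "\<dots> = {a<..n}" unfolding w(2) by auto
    finally show ?thesis .
  qed
  have "greater_before a w = filter ((<) a) P"
    using PQ w(1) by (auto simp: greater_before_append) (simp add: greater_before_def)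
  also have "\<dots> = P" using * by (auto simp: filter_id_conv)
  finally have gb: "greater_before a w = P" .
  have posQ: "\<forall>x\<in>set Q. pos w x < length Q"
    using pos_less_length[of _ Q] PQ by (simp add: pos_append pos_Cons)
  have posP: "\<forall>x\<in>set P. pos w x = Suc (length Q + pos P x)"
    using w(1) PQ by (auto simp: pos_append pos_Cons)
  have "pos w a = length Q" "distinct P" "distinct Q" and disj: "set P \<inter> set Q = {}"
    using PQ w(1) by auto
  then show thesis by (rule that[OF PQ gb _ _ _ * _ posP posQ])
qed

lemma lag_eq_0_iff:
  assumes w: "distinct w" "set w = {a..n}" and an: "a < n"
  shows "lag a w = 0 \<longleftrightarrow> pos w a = 0 \<and> pos w n = 1"
proof -
  obtain P Q where PQ: "greater_before a w = P" "pos w a = length Q"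
    "distinct P" "set P \<union> set Q = {a<..n}"
    "\<forall>x\<in>set P. pos w x = Suc (length Q + pos P x)"
    using greater_before_split[OF w] an by (metis less_imp_le)
  show ?thesis
  proof (cases "Q = []")
    case True
    then have "n \<in> set P" "\<forall>x\<in>set P. x \<le> n" using PQ an by auto
    then show ?thesis
      using PQ True defect_eq_0_iff_pos[of P n] by (simp add: lag_def)
  qed (simp add: lag_def PQ)
qed

lemma lag_eq_1_iff:
  assumes w: "distinct w" "set w = {a..n}" and an: "a + 3 \<le> n"
  shows "lag a w = 1 \<longleftrightarrow> lag_1_shape (pos w) a n"
proof -
  obtain k where "n = a + 3 + k" using le_Suc_ex[OF an] by blast
  then have n: "n = Suc (Suc (Suc (a + k)))" by simp
  obtain P Q where PQ: "greater_before a w = P" "pos w a = length Q"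
    "distinct P" "set P \<union> set Q = {a<..n}" "set P \<inter> set Q = {}"
    "\<forall>x\<in>set P. pos w x = Suc (length Q + pos P x)" "\<forall>x\<in>set Q. pos w x < length Q"
    using greater_before_split[OF w] an by (metis add_leE)
  consider "Q = []" | q where "Q = [q]" | "length Q \<ge> 2"
    by (cases Q; cases "tl Q") auto
  then show ?thesis
  proof cases
    case 1
    have P: "set P = {a<..n}" using PQ(4) 1 by simp
    have "lag a w = 1 \<longleftrightarrow> defect P = 1" using PQ(1,2) 1 by (simp add: lag_def)
    also have "\<dots> \<longleftrightarrow> pos P n = 1 \<or> pos P (n - 1) = 0 \<and> pos P (n - 2) < pos P n"
      using P PQ(3) n by (intro defect_eq_1_iff_pos) auto
    also have "\<dots> \<longleftrightarrow> lag_1_shape (pos w) a n"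
      using PQ(2,6) 1 P n by (simp add: lag_1_shape_def)
    finally show ?thesis .
  next
    case (2 q)
    define m where "m = (if q = n then n - 1 else n)"
    have P: "set P = {a<..n} - {q}" using PQ(4,5) 2 by auto
    then have m: "m \<in> set P" using n by (auto simp: m_def)
    have "lag a w = 1 \<longleftrightarrow> defect P = 0" using PQ(1,2) 2 by (simp add: lag_def)
    also have "\<dots> \<longleftrightarrow> pos P m = 0"
      using P m PQ(3) n by (intro defect_eq_0_iff_pos) (auto simp: m_def)
    also have "\<dots> \<longleftrightarrow> pos w m = 2" using PQ(6) m 2 by simp
    also have "\<dots> \<longleftrightarrow> lag_1_shape (pos w) a n"
      using PQ(2,6,7) 2 P n unfolding m_def lag_1_shape_def by (cases "q = n") auto
    finally show ?thesis .
  next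
    case 3
    then have "pos w a \<ge> 2" using PQ(2) by simp
    then show ?thesis by (auto simp: lag_def lag_1_shape_def)
  qed
qed

text \<open>The bound makes \<open>n - 4\<close>, ..., \<open>n\<close> greater than
  \<open>a\<close>, so that five top letters exist when nothing follows \<open>a\<close>. For a = 1
  it reads n >= 6.\<close>

lemma lag_eq_2_iff:
  assumes w: "distinct w" "set w = {a..n}" and an: "a + 5 \<le> n"
  shows "lag a w = 2 \<longleftrightarrow> lag_2_shape (pos w) a n"
proof -
  obtain k where "n = a + 5 + k" using le_Suc_ex[OF an] by blast
  then have n: "n = Suc (Suc (Suc (Suc (Suc (a + k)))))" by simp
  obtain P Q where PQ: "greater_before a w = P" "pos w a = length Q"
    "distinct P" "set P \<union> set Q = {a<..n}" "set P \<inter> set Q = {}"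
    "\<forall>x\<in>set P. pos w x = Suc (length Q + pos P x)" "\<forall>x\<in>set Q. pos w x < length Q"
    and dQ: "distinct Q"
    using greater_before_split[OF w] an by (metis add_leE)
  consider "Q = []" | q where "Q = [q]" | q r where "Q = [q, r]" | "length Q \<ge> 3"
    by (cases Q; cases "tl Q"; cases "tl (tl Q)") auto
  then show ?thesis
  proof cases
    case 1
    have P: "set P = {a<..n}" using PQ(4) 1 by simp
    have "lag a w = 2 \<longleftrightarrow> defect P = 2" using PQ(1,2) 1 by (simp add: lag_def)
    also have "\<dots> \<longleftrightarrow> defect_2_shape (pos P) n (n - 1) (n - 2) (n - 3) (n - 4)"
      using P PQ(3) n by (intro defect_eq_2_iff_pos) (auto simp: top_letters_def)
    also have "\<dots> \<longleftrightarrow> lag_2_shape (pos w) a n"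
      using PQ(2,6) 1 P n by (simp add: lag_2_shape_def defect_2_shape_def)
    finally show ?thesis .
  next
    case (2 q)
    \<comment> \<open>\<open>m1\<close>, \<open>m2\<close>, \<open>m3\<close> are the three largest
      letters once \<open>q\<close> is left out.\<close>
    define m1 where "m1 = (if q = n then n - 1 else n)"
    define m2 where "m2 = (if q = n \<or> q = n - 1 then n - 2 else n - 1)"
    define m3 where "m3 = (if q = n \<or> q = n - 1 \<or> q = n - 2 then n - 3 else n - 2)"
    have P: "set P = {a<..n} - {q}" using PQ(4,5) 2 by auto
    then have m: "m1 \<in> set P" "m2 \<in> set P" "m3 \<in> set P" using n by (auto simp: m1_def m2_def m3_def)
    have "lag a w = 2 \<longleftrightarrow> defect P = 1" using PQ(1,2) 2 by (simp add: lag_def)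
    also have "\<dots> \<longleftrightarrow> pos P m1 = 1 \<or> pos P m2 = 0 \<and> pos P m3 < pos P m1"
    proof (rule defect_eq_1_iff_pos[OF PQ(3) m])
      show "m2 < m1" "m3 < m2" using n by (auto simp: m1_def m2_def m3_def)
      show "\<forall>x\<in>set P. x = m1 \<or> x = m2 \<or> x \<le> m3"
      proof
        fix x assume "x \<in> set P"
        then have "x \<le> n" "x \<noteq> q" using P by auto
        then show "x = m1 \<or> x = m2 \<or> x \<le> m3"
          unfolding m1_def m2_def m3_def by (cases "q = n"; cases "q = n - 1"; cases "q = n - 2"; simp; arith)
      qed
    qed
    also have "\<dots> \<longleftrightarrow> pos w m1 = 3 \<or> pos w m2 = 2 \<and> pos w m3 < pos w m1" using PQ(6) m 2 by auto
    also have "\<dots> \<longleftrightarrow> lag_2_shape (pos w) a n"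
    proof -
      have "pos w x = 0 \<longleftrightarrow> x = q" if "x \<in> {n, n - 1, n - 2}" for x
        using that PQ(6,7) 2 P n by (cases "x = q") auto
      moreover have "pos w a = 1" using PQ(2) 2 by simp
      moreover have "n \<noteq> n - 1" "n \<noteq> n - 2" "n - 1 \<noteq> n - 2" using n by auto
      ultimately show ?thesis
        unfolding m1_def m2_def m3_def lag_2_shape_def by simp
    qed
    finally show ?thesis .
  next
    case (3 q r)
    \<comment> \<open>\<open>m\<close> is the largest letter outside \<open>q\<close> and
      \<open>r\<close>, hence the maximum of \<open>P\<close>.\<close>
    define m where "m = (if n \<in> {q, r} then if n - 1 \<in> {q, r} then n - 2 else n - 1 else n)"
    have P: "set P = {a<..n} - {q, r}" using PQ(4,5) 3 by auto
    have qr: "q \<noteq> r" using dQ 3 by simp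
    have "m \<in> {n, n - 1, n - 2}"
      unfolding m_def by (cases "n \<in> {q, r}"; cases "n - 1 \<in> {q, r}") simp_all
    then have "a < m" "m \<le> n" using an by auto
    moreover have "m \<notin> {q, r}"
      unfolding m_def using n qr by (cases "n = q"; cases "n = r"; cases "n - 1 = q"; cases "n - 1 = r") (simp_all, arith+)
    ultimately have m: "m \<in> set P" using P by simp
    have m_top: "\<forall>x\<in>set P. x \<le> m"
    proof
      fix x assume "x \<in> set P"
      then have x: "x \<le> n" "x \<noteq> q" "x \<noteq> r" using P by auto
      consider "n \<notin> {q, r}" | "n \<in> {q, r}" "n - 1 \<notin> {q, r}" | "n \<in> {q, r}" "n - 1 \<in> {q, r}"
        by auto
      then show "x \<le> m"
      proof cases
        case 3
        then have "x \<noteq> n" "x \<noteq> n - 1" using x by auto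
        moreover have "m = n - 2" unfolding m_def using 3 by (simp only: if_True)
        ultimately show ?thesis using x(1) by simp
      qed (use x in \<open>auto simp: m_def\<close>)
    qed
    have "lag a w = 2 \<longleftrightarrow> defect P = 0" using PQ(1,2) 3 by (simp add: lag_def)
    also have "\<dots> \<longleftrightarrow> pos P m = 0"
      using PQ(3) m m_top by (rule defect_eq_0_iff_pos)
    also have "\<dots> \<longleftrightarrow> pos w m = 3" using PQ(6) m 3 by simp
    also have "\<dots> \<longleftrightarrow> lag_2_shape (pos w) a n"
    proof -
      have "pos w x < 2 \<longleftrightarrow> x \<in> {q, r}" if "x \<in> {n, n - 1, n - 2}" for x
        using that PQ(6,7) 3 P n by (cases "x \<in> {q, r}") auto
      from this[of n] this[of "n - 1"] this[of "n - 2"]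
      have "pos w n < 2 \<longleftrightarrow> n \<in> {q, r}" "pos w (n - 1) < 2 \<longleftrightarrow> n - 1 \<in> {q, r}"
        "pos w (n - 2) < 2 \<longleftrightarrow> n - 2 \<in> {q, r}" by blast+
      moreover have "pos w a = 2" using PQ(2) 3 by simp
      ultimately show ?thesis
        unfolding m_def lag_2_shape_def by (cases "n \<in> {q, r}"; cases "n - 1 \<in> {q, r}") simp_all
    qed
    finally show ?thesis .
  next
    case 4
    then have "pos w a \<ge> 3" using PQ(2) by simp
    then show ?thesis by (auto simp: lag_def lag_2_shape_def)
  qed
qed

text \<open>Of the n - a letters greater than \<open>a\<close>, \<open>pos w a\<close> stand to its
  right; the others form the word before \<open>a\<close>, whose length is the sum of its passes and
  its defect.\<close>

lemma passes_lag:
  assumes w: "distinct w" "set w = {a..n}" and an: "a \<le> n"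
  shows "passes (greater_before a w) + lag a w = n - a"
proof -
  obtain P Q where PQ: "greater_before a w = P" "pos w a = length Q" "w = P @ a # Q" "distinct P"
    using greater_before_split[OF w an] by metis
  have "length w = Suc n - a" using w by (metis card_atLeastAtMost distinct_card)
  then show ?thesis using PQ length_eq_passes_defect[of P] an by (simp add: lag_def)
qed

lemma greater_before_filter: "greater_before a (filter ((\<le>) a) w) = greater_before a w"
  unfolding greater_before_def by (induction w) auto

lemma pos_filter_neq:
  assumes "distinct w" "x \<in> set w" "y \<in> set w" "x \<noteq> y"
  shows "pos (filter (\<lambda>z. z \<noteq> y) w) x = pos w x - of_bool (pos w y < pos w x)"
proof -
  obtain u v where w: "w = u @ x # v" using assms(2) by (meson split_list)
  have "y \<in> set v \<longleftrightarrow> pos w y < length v"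
    using assms w by (auto simp: pos_append pos_Cons dest: pos_less_length)
  moreover have "length (filter (\<lambda>z. z \<noteq> y) v) = length v - of_bool (y \<in> set v)"
  proof -
    have "length (filter (\<lambda>z. z \<noteq> y) v) = card (set v - {y})"
      using assms w by (subst distinct_card[symmetric]) (auto intro: arg_cong[of _ _ card])
    also have "\<dots> = length v - of_bool (y \<in> set v)"
      using assms w distinct_card[of v] by (simp add: card_Diff_singleton_if)
    finally show ?thesis .
  qed
  ultimately show ?thesis using assms w by simp
qed

text \<open>By \<open>passes_lag\<close>, n - 3 passes suffice for the letter a iff a + lag >= 3,
  and n - 4 passes suffice iff a + lag >= 4. Letters from 3 on, respectively from 4 on, impose no
  condition. Complexity n - 3 is the first property without the second.\<close>

lemma mem_E_iff_lag:
  assumes \<pi>: "\<pi> \<in> perms n" and n: "n \<ge> 6"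
  defines "w \<equiv> \<lambda>a. filter ((\<le>) a) \<pi>"
  shows "\<pi> \<in> E n (n - 3) \<longleftrightarrow> lag 1 (w 1) > 1 \<and> lag 2 (w 2) > 0 \<and>
    (lag 1 (w 1) = 2 \<or> lag 2 (w 2) = 1 \<or> lag 3 (w 3) = 0)"
proof -
  have p: "passes (greater_before a \<pi>) + lag a (w a) + a = n" if "a \<in> {1..n}" for a
  proof -
    have "passes (greater_before a (w a)) + lag a (w a) = n - a"
      using \<pi> that by (intro passes_lag) (auto simp: w_def permutations_of_set_def)
    then show ?thesis using that by (simp add: w_def greater_before_filter)
  qed
  have p123: "passes (greater_before 1 \<pi>) + lag 1 (w 1) + 1 = n"
    "passes (greater_before 2 \<pi>) + lag 2 (w 2) + 2 = n" "passes (greater_before 3 \<pi>) + lag 3 (w 3) + 3 = n"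
    using n by (intro p; simp)+
  have "stack_complexity n \<pi> \<le> n - 3 \<longleftrightarrow> lag 1 (w 1) > 1 \<and> lag 2 (w 2) > 0"
  proof
    assume "stack_complexity n \<pi> \<le> n - 3"
    then have "passes (greater_before 1 \<pi>) \<le> n - 3" "passes (greater_before 2 \<pi>) \<le> n - 3"
      using n by (auto simp: stack_complexity_le_iff[OF \<pi>])
    then show "lag 1 (w 1) > 1 \<and> lag 2 (w 2) > 0" using p123 n by linarith
  next
    assume *: "lag 1 (w 1) > 1 \<and> lag 2 (w 2) > 0"
    have "passes (greater_before a \<pi>) \<le> n - 3" if a: "a \<in> {1..n}" for a
    proof -
      consider "a = 1" | "a = 2" | "a \<ge> 3" using a by fastforce
      then show ?thesis using p[OF a] * n by cases auto
    qed
    then show "stack_complexity n \<pi> \<le> n - 3" by (simp add: stack_complexity_le_iff[OF \<pi>])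
  qed
  moreover have "stack_complexity n \<pi> \<le> n - 4 \<longleftrightarrow> lag 1 (w 1) > 2 \<and> lag 2 (w 2) > 1 \<and> lag 3 (w 3) > 0"
  proof
    assume "stack_complexity n \<pi> \<le> n - 4"
    then have "passes (greater_before 1 \<pi>) \<le> n - 4" "passes (greater_before 2 \<pi>) \<le> n - 4"
      "passes (greater_before 3 \<pi>) \<le> n - 4"
      using n by (auto simp: stack_complexity_le_iff[OF \<pi>])
    then show "lag 1 (w 1) > 2 \<and> lag 2 (w 2) > 1 \<and> lag 3 (w 3) > 0" using p123 n by linarith
  next
    assume *: "lag 1 (w 1) > 2 \<and> lag 2 (w 2) > 1 \<and> lag 3 (w 3) > 0"
    have "passes (greater_before a \<pi>) \<le> n - 4" if a: "a \<in> {1..n}" for a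
    proof -
      consider "a = 1" | "a = 2" | "a = 3" | "a \<ge> 4" using a by fastforce
      then show ?thesis using p[OF a] * n by cases auto
    qed
    then show "stack_complexity n \<pi> \<le> n - 4" by (simp add: stack_complexity_le_iff[OF \<pi>])
  qed
  moreover have "\<pi> \<in> E n (n - 3) \<longleftrightarrow> stack_complexity n \<pi> \<le> n - 3 \<and> \<not> stack_complexity n \<pi> \<le> n - 4"
    using \<pi> n by (auto simp: E_def)
  ultimately show ?thesis by auto
qed

text \<open>Deleting a letter lowers by one exactly the positions to its left. Thus \<open>q\<close>
  and \<open>r\<close> express the positions in the words without 1, and without 1 and 2, through
  positions in \<pi>, and all three lags become conditions on \<open>p\<close>.\<close>

lemma mem_E_iff_pos:
  assumes \<pi>: "\<pi> \<in> perms n" and n: "n \<ge> 6"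
  defines "p \<equiv> pos \<pi>"
  defines "q \<equiv> \<lambda>x. p x - of_bool (p 1 < p x)"
  defines "r \<equiv> \<lambda>x. q x - of_bool (q 2 < q x)"
  shows "\<pi> \<in> E n (n - 3) \<longleftrightarrow>
    \<not> (p 1 = 0 \<and> p n = 1) \<and> \<not> lag_1_shape p 1 n \<and> \<not> (q 2 = 0 \<and> q n = 1) \<and>
    (lag_2_shape p 1 n \<or> lag_1_shape q 2 n \<or> r 3 = 0 \<and> r n = 1)"
proof -
  have d: "distinct \<pi>" "set \<pi> = {1..n}" using \<pi> by (auto simp: permutations_of_set_def)
  have w1: "filter ((\<le>) 1) \<pi> = \<pi>" using d by (auto simp: filter_id_conv)
  have w2: "filter ((\<le>) 2) \<pi> = filter (\<lambda>z. z \<noteq> 1) \<pi>" using d by (auto intro!: filter_cong)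
  have w3: "filter ((\<le>) 3) \<pi> = filter (\<lambda>z. z \<noteq> 2) (filter (\<lambda>z. z \<noteq> 1) \<pi>)"
    using d by (auto simp: filter_filter intro!: filter_cong)
  have set2: "distinct (filter ((\<le>) 2) \<pi>)" "set (filter ((\<le>) 2) \<pi>) = {2..n}" using d by auto
  have set3: "distinct (filter ((\<le>) 3) \<pi>)" "set (filter ((\<le>) 3) \<pi>) = {3..n}" using d by auto
  have q: "pos (filter ((\<le>) 2) \<pi>) x = q x" if "x \<in> {2..n}" for x
    unfolding w2 p_def q_def using that d n by (subst pos_filter_neq) auto
  have r: "pos (filter ((\<le>) 3) \<pi>) x = r x" if "x \<in> {3..n}" for x
    unfolding w3 r_def using that d n q[of x] q[of 2] by (subst pos_filter_neq) (auto simp: w2)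
  have "lag 1 \<pi> = 0 \<longleftrightarrow> p 1 = 0 \<and> p n = 1"
    unfolding p_def using d n by (intro lag_eq_0_iff) auto
  moreover have "lag 1 \<pi> = 1 \<longleftrightarrow> lag_1_shape p 1 n"
    unfolding p_def using d n by (intro lag_eq_1_iff) auto
  moreover have "lag 1 \<pi> = 2 \<longleftrightarrow> lag_2_shape p 1 n"
    unfolding p_def using d n by (intro lag_eq_2_iff) auto
  moreover have "lag 2 (filter ((\<le>) 2) \<pi>) = 0 \<longleftrightarrow> q 2 = 0 \<and> q n = 1"
    using lag_eq_0_iff[OF set2] n q[of 2] q[of n] by simp
  moreover have "lag 2 (filter ((\<le>) 2) \<pi>) = 1 \<longleftrightarrow> lag_1_shape q 2 n"
    using lag_eq_1_iff[OF set2] n q[of 2] q[of n] q[of "n - 1"] q[of "n - 2"]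
    by (simp add: lag_1_shape_def)
  moreover have "lag 3 (filter ((\<le>) 3) \<pi>) = 0 \<longleftrightarrow> r 3 = 0 \<and> r n = 1"
    using lag_eq_0_iff[OF set3] n r[of 3] r[of n] by simp
  moreover have "1 < k \<longleftrightarrow> k \<noteq> 0 \<and> k \<noteq> 1" for k :: nat by auto
  ultimately show ?thesis
    unfolding mem_E_iff_lag[OF \<pi> n] w1 by (simp only: neq0_conv[symmetric]) blast
qed

section \<open>Glob patterns in terms of positions\<close>

lemma append_mem_glob: "u \<in> glob ps \<Longrightarrow> v \<in> glob qs \<Longrightarrow> u @ v \<in> glob (ps @ qs)"
proof (induction ps arbitrary: u rule: glob.induct)
  case (2 ps)
  then obtain x y where u: "u = x @ y" "set x \<subseteq> {1..}" "y \<in> glob ps" by auto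
  then have "y @ v \<in> glob (ps @ qs)" using 2 by blast
  then show ?case using u by (metis (mono_tags, lifting) append.assoc append_Cons glob.simps(2) mem_Collect_eq)
qed auto

lemma rev_mem_glob: "w \<in> glob ps \<Longrightarrow> rev w \<in> glob (rev ps)"
proof (induction ps arbitrary: w rule: glob.induct)
  case (2 ps)
  then obtain u v where w: "w = u @ v" "set u \<subseteq> {1..}" "v \<in> glob ps" by auto
  then have "rev v \<in> glob (rev ps)" "rev u \<in> glob [Star]" using 2 by simp_all
  then show ?case using append_mem_glob unfolding w(1) by fastforce
next
  case (3 ps)
  then obtain a v where w: "w = a # v" "[a] \<in> glob [Any]" "v \<in> glob ps" by auto
  then show ?case using 3 append_mem_glob[of "rev v" "rev ps" "[a]" "[Any]"] by simp
next
  case (4 a ps)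
  then obtain v where w: "w = a # v" "v \<in> glob ps" by auto
  then show ?case using 4 append_mem_glob[of "rev v" "rev ps" "[a]" "[Lit a]"] by simp
qed simp

text \<open>The patterns are anchored at the right end, where positions are counted from, so the
  reversed word is matched. \<open>drop 0\<close> brings membership into the form on which the rules
  below consume one symbol at a time.\<close>

lemma mem_glob_iff_rev: "w \<in> glob ps \<longleftrightarrow> drop 0 (rev w) \<in> glob (rev ps)"
  using rev_mem_glob[of w ps] rev_mem_glob[of "rev w" "rev ps"] by auto

lemma pos_eq_iff_nth:
  assumes "distinct w" "a \<in> set w" "k < length w"
  shows "rev w ! k = a \<longleftrightarrow> pos w a = k"
  using assms nth_rev_pos[of a w] pos_less_length[of a w]
  by (metis distinct_rev length_rev nth_eq_iff_index_eq)

context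
  fixes w :: "nat list"
  assumes w: "distinct w" "set w \<subseteq> {1..}"
begin

lemma drop_rev_mem_glob_Any:
  "drop k (rev w) \<in> glob (Any # ps) \<longleftrightarrow> k < length w \<and> drop (Suc k) (rev w) \<in> glob ps"
proof (cases "k < length w")
  case True
  then have "drop k (rev w) = rev w ! k # drop (Suc k) (rev w)" by (simp add: Cons_nth_drop_Suc)
  moreover have "rev w ! k \<in> {1..}" using w True by (metis length_rev nth_mem set_rev subsetD)
  ultimately show ?thesis using True by auto
qed auto

lemma drop_rev_mem_glob_Lit:
  assumes "a \<in> set w"
  shows "drop k (rev w) \<in> glob (Lit a # ps) \<longleftrightarrow> pos w a = k \<and> drop (Suc k) (rev w) \<in> glob ps"
proof (cases "k < length w")
  case True
  then have "drop k (rev w) = rev w ! k # drop (Suc k) (rev w)" by (simp add: Cons_nth_drop_Suc)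
  then show ?thesis using pos_eq_iff_nth[OF w(1) assms True] by auto
qed (use pos_less_length[OF assms] in auto)

lemma drop_rev_mem_glob_Star_Nil: "drop k (rev w) \<in> glob [Star]"
  using w set_drop_subset[of k "rev w"] by auto

lemma drop_rev_mem_glob_Star:
  "drop k (rev w) \<in> glob (Star # ps) \<longleftrightarrow> (\<exists>j\<ge>k. drop j (rev w) \<in> glob ps)"
proof
  assume "drop k (rev w) \<in> glob (Star # ps)"
  then obtain u v where "drop k (rev w) = u @ v" "v \<in> glob ps" by auto
  then have "drop (length u + k) (rev w) \<in> glob ps" by (metis append_eq_conv_conj drop_drop)
  then show "\<exists>j\<ge>k. drop j (rev w) \<in> glob ps" by (metis le_add2)
next
  assume "\<exists>j\<ge>k. drop j (rev w) \<in> glob ps"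
  then obtain i where "drop (i + k) (rev w) \<in> glob ps" by (metis le_add_diff_inverse2)
  moreover have "drop k (rev w) = take i (drop k (rev w)) @ drop (i + k) (rev w)"
    by (metis append_take_drop_id drop_drop)
  moreover have "set (take i (drop k (rev w))) \<subseteq> {1..}"
    using w set_drop_subset[of k "rev w"] set_take_subset[of i "drop k (rev w)"] by auto
  ultimately show "drop k (rev w) \<in> glob (Star # ps)" by auto
qed

text \<open>\<open>a\<close> occurs only once, so its position determines the length of the word
  matched by the star and the existential quantifier disappears.\<close>

lemma drop_rev_mem_glob_Star_Lit:
  assumes "a \<in> set w"
  shows "drop k (rev w) \<in> glob (Star # Lit a # ps) \<longleftrightarrow> k \<le> pos w a \<and> drop (Suc (pos w a)) (rev w) \<in> glob ps"
  unfolding drop_rev_mem_glob_Star drop_rev_mem_glob_Lit[OF assms] by auto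

end

section \<open>Permutations with prescribed positions and relative order\<close>

text \<open>The permutation is built one letter at a time: composing with a transposition corrects
  the image of the new letter and moves none of the images already prescribed.\<close>

lemma permutes_map_list:
  assumes "finite S" "distinct us" "distinct vs" "set us \<subseteq> S" "set vs \<subseteq> S" "length us = length vs"
  shows "\<exists>\<sigma>. \<sigma> permutes S \<and> map \<sigma> us = vs"
  using assms(6,2-5)
proof (induction us vs rule: list_induct2)
  case Nil
  then show ?case using permutes_id by (metis list.simps(8))
next
  case (Cons u us v vs)
  then obtain \<sigma> where \<sigma>: "\<sigma> permutes S" "map \<sigma> us = vs" by auto
  have "\<sigma> u \<in> S" "\<sigma> u \<notin> set vs"
    using \<sigma> Cons.prems permutes_in_image[OF \<sigma>(1)] permutes_inj[OF \<sigma>(1)] by (auto dest: injD)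
  then have "transpose (\<sigma> u) v permutes S" "map (transpose (\<sigma> u) v) vs = vs"
    using Cons.prems by (auto intro!: permutes_swap_id map_idI transpose_apply_other)
  moreover from this(1) have "(transpose (\<sigma> u) v \<circ> \<sigma>) permutes S" by (rule permutes_compose[OF \<sigma>(1)])
  moreover have "map (transpose (\<sigma> u) v \<circ> \<sigma>) (u # us) = v # map (transpose (\<sigma> u) v) (map \<sigma> us)" by simp
  ultimately show ?case using \<sigma>(2) by metis
qed

lemma pos_map:
  assumes "inj \<sigma>"
  shows "pos (map \<sigma> w) (\<sigma> a) = pos w a"
  using inj_eq[OF assms] by (simp add: pos_def rev_map takeWhile_map comp_def)

lemma map_mem_perms_iff:
  assumes "\<sigma> permutes {1..n}"
  shows "map \<sigma> w \<in> perms n \<longleftrightarrow> w \<in> perms n"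
proof -
  have "\<sigma> ` set w = {1..n} \<longleftrightarrow> set w = {1..n}"
    by (metis assms permutes_image permutes_inj inj_image_eq_iff)
  then show ?thesis using permutes_inj[OF assms]
    by (auto simp: permutations_of_set_def distinct_map intro: inj_on_subset)
qed

lemma card_perms_relabel:
  assumes \<sigma>: "\<sigma> permutes {1..n}" and PQ: "\<And>w. w \<in> perms n \<Longrightarrow> Q (map \<sigma> w) \<longleftrightarrow> P w"
  shows "card {w \<in> perms n. P w} = card {w \<in> perms n. Q w}"
proof -
  have "map \<sigma> ` {w \<in> perms n. P w} = {w \<in> perms n. Q w}"
  proof (intro set_eqI iffI)
    fix w assume w: "w \<in> {w \<in> perms n. Q w}"
    have "w = map \<sigma> (map (inv \<sigma>) w)" using permutes_inverses[OF \<sigma>] by (simp add: comp_def)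
    then show "w \<in> map \<sigma> ` {w \<in> perms n. P w}"
      using w PQ[of "map (inv \<sigma>) w"] map_mem_perms_iff[OF \<sigma>, of "map (inv \<sigma>) w"]
      by (metis (mono_tags, lifting) image_eqI mem_Collect_eq)
  qed (use PQ map_mem_perms_iff[OF \<sigma>] in auto)
  moreover have "inj_on (map \<sigma>) {w \<in> perms n. P w}"
    using permutes_inj[OF \<sigma>] by (rule inj_on_subset[OF inj_mapI]) simp
  then have "card (map \<sigma> ` {w \<in> perms n. P w}) = card {w \<in> perms n. P w}" by (rule card_image)
  ultimately show ?thesis by simp
qed

lemma card_fibres:
  assumes "finite A" "finite B" "\<And>x. x \<in> A \<Longrightarrow> f x \<in> B" "\<And>b. b \<in> B \<Longrightarrow> card {x \<in> A. f x = b} = c"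
  shows "card A = card B * c"
proof -
  have "card A = card (\<Union>b\<in>B. {x \<in> A. f x = b})" using assms(3) by (intro arg_cong[of _ _ card]) auto
  also have "\<dots> = (\<Sum>b\<in>B. card {x \<in> A. f x = b})"
    using assms(1,2) by (intro card_UN_disjoint) auto
  finally have "card A = (\<Sum>b\<in>B. card {x \<in> A. f x = b})" .
  then show ?thesis using assms(4) by simp
qed

text \<open>Relabelling letters is transitive on the possible contents of the positions
  \<open>js\<close>, so all injective contents occur equally often. There are n! / (n - k)! of them,
  where k is the length of \<open>vs\<close>.\<close>

lemma card_perms_fixed:
  assumes vs: "distinct vs" "set vs \<subseteq> {1..n}" and js: "distinct js" "set js \<subseteq> {..<n}"
    and len: "length vs = length js"
  shows "card {w \<in> perms n. map (pos w) vs = js} = fact (n - length vs)"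
proof -
  let ?B = "{us. length us = length vs \<and> distinct us \<and> set us \<subseteq> {1..n}}"
  define letters where "letters w = map (\<lambda>i. rev w ! i) js" for w :: "nat list"
  have w: "distinct w" "set w = {1..n}" "length w = n" if "w \<in> perms n" for w
    using that distinct_card[of w] by (auto simp: permutations_of_set_def)
  have count: "card (perms n) = card ?B * card {w \<in> perms n. letters w = vs}"
  proof (rule card_fibres[where f = letters])
    show "finite ?B" by (rule finite_subset[OF _ finite_lists_length_eq[of "{1..n}" "length vs"]]) auto
    show "letters w \<in> ?B" if "w \<in> perms n" for w
    proof -
      have "inj_on (\<lambda>i. rev w ! i) (set js)"
        using w[OF that] js by (intro inj_onI) (metis distinct_rev length_rev lessThan_iff nth_eq_iff_index_eq subsetD)
      moreover have "rev w ! i \<in> {1..n}" if "i \<in> set js" for i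
        using that js w[OF \<open>w \<in> perms n\<close>] by (metis length_rev lessThan_iff nth_mem set_rev subsetD)
      ultimately show ?thesis using js len by (auto simp: letters_def distinct_map)
    qed
    show "card {w \<in> perms n. letters w = us} = card {w \<in> perms n. letters w = vs}" if us: "us \<in> ?B" for us
    proof -
      obtain \<sigma> where \<sigma>: "\<sigma> permutes {1..n}" "map \<sigma> us = vs"
        using permutes_map_list[of "{1..n}" us vs] us vs by blast
      have "letters (map \<sigma> w) = map \<sigma> (letters w)" if "w \<in> perms n" for w
        using js w[OF that] by (auto simp: letters_def rev_map)
      then show ?thesis
        using \<sigma> by (intro card_perms_relabel[OF \<sigma>(1)]) (metis inj_map_eq_map permutes_inj)
    qed
  qed simp
  have "letters w = vs \<longleftrightarrow> map (pos w) vs = js" if "w \<in> perms n" for w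
  proof -
    have "rev w ! i = v \<longleftrightarrow> pos w v = i" if "i < n" "v \<in> {1..n}" for i v
      using that w[OF \<open>w \<in> perms n\<close>] nth_rev_pos[of v w] pos_less_length[of v w]
      by (metis distinct_rev length_rev nth_eq_iff_index_eq)
    then have "rev w ! (js ! k) = vs ! k \<longleftrightarrow> pos w (vs ! k) = js ! k" if "k < length js" for k
      using that vs(2) js(2) len by (metis lessThan_iff nth_mem subsetD)
    then show ?thesis using len by (simp add: letters_def list_eq_iff_nth_eq)
  qed
  then have fibre: "{w \<in> perms n. letters w = vs} = {w \<in> perms n. map (pos w) vs = js}" by blast
  have "length vs \<le> n" using vs card_mono[of "{1..n}" "set vs"] by (simp add: distinct_card)
  \<comment> \<open>\<open>card ?B\<close> is a falling factorial; multiplied by the missing factors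
    it gives n!.\<close>
  then have B: "card ?B * fact (n - length vs) = fact n"
    using fact_div_fact[of "n - length vs" n] dvd_div_mult_self[OF fact_dvd[of "n - length vs" n, where ?'a = nat]]
    by (simp add: card_lists_distinct_length_eq Suc_diff_le)
  have "card ?B * card {w \<in> perms n. map (pos w) vs = js} = card (perms n)"
    by (simp only: count fibre)
  also have "\<dots> = fact n" by (subst card_permutations_of_set) simp_all
  also have "\<dots> = card ?B * fact (n - length vs)" by (rule B[symmetric])
  finally have eq: "card ?B * card {w \<in> perms n. map (pos w) vs = js} = card ?B * fact (n - length vs)" .
  have "card ?B \<noteq> 0"
  proof
    assume "card ?B = 0"
    then have "(fact n :: nat) = 0" unfolding B[symmetric] by (simp only: mult_0)
    then show False by simp
  qed
  from eq show ?thesis unfolding mult_left_cancel[OF \<open>card ?B \<noteq> 0\<close>] .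
qed

text \<open>Permuting the letters of \<open>us\<close> among themselves leaves the letters of
  \<open>vs\<close> in place and carries any order of \<open>us\<close> into any other, so all
  orders are equally frequent. The product form keeps the statement within the natural
  numbers.\<close>

lemma card_perms_fixed_ordered:
  assumes vs: "distinct vs" "set vs \<subseteq> {1..n}" and js: "distinct js" "set js \<subseteq> {..<n}"
    and len: "length vs = length js"
    and us: "distinct us" "set us \<subseteq> {1..n}" "set us \<inter> set vs = {}"
  shows "fact (length us) * card {w \<in> perms n. map (pos w) vs = js \<and> sorted_wrt (<) (map (pos w) us)}
    = fact (n - length vs)"
proof -
  let ?A = "{w \<in> perms n. map (pos w) vs = js}"
  define order where "order w = sort_key (pos w) us" for w
  have w: "distinct w" "set w = {1..n}" "length w = n" if "w \<in> perms n" for w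
    using that distinct_card[of w] by (auto simp: permutations_of_set_def)
  have inj: "inj_on (pos w) (set us)" if "w \<in> perms n" for w
  proof (rule inj_onI)
    fix x y assume "x \<in> set us" "y \<in> set us" "pos w x = pos w y"
    then show "x = y" using us(2) w(2)[OF that] by (intro pos_inj[of x w y]) auto
  qed
  have order_iff: "order w = xs \<longleftrightarrow> sorted_wrt (<) (map (pos w) xs)" if "w \<in> perms n" "xs \<in> permutations_of_set (set us)" for w xs
  proof -
    have xs: "distinct xs" "set xs = set us" using that by (auto simp: permutations_of_set_def)
    then have "sorted (map (pos w) xs) \<longleftrightarrow> sorted_wrt (<) (map (pos w) xs)"
      using inj[OF that(1)] by (simp add: strict_sorted_iff distinct_map)
    moreover have "order w = xs \<longleftrightarrow> sorted (map (pos w) xs)"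
    proof
      assume "sorted (map (pos w) xs)"
      moreover have "distinct (map (pos w) us)" "distinct (map (pos w) xs)"
        using inj[OF that(1)] us(1) xs by (simp_all add: distinct_map)
      moreover have "sorted (map (pos w) (order w))" "set (order w) = set us" "distinct (order w)"
        using us(1) by (simp_all add: order_def)
      ultimately have "map (pos w) (order w) = map (pos w) xs"
        using inj[OF that(1)] xs by (intro sorted_distinct_set_unique) (auto simp: distinct_map)
      then show "order w = xs"
        using inj[OF that(1)] xs \<open>set (order w) = set us\<close> by (metis inj_on_map_eq_map sup.idem)
    qed (auto simp: order_def)
    ultimately show ?thesis by blast
  qed
  have "card ?A = card (permutations_of_set (set us)) * card {w \<in> ?A. order w = us}"
  proof (rule card_fibres[where f = order])
    show "order w \<in> permutations_of_set (set us)" if "w \<in> ?A" for w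
      using us(1) by (simp add: order_def permutations_of_set_def)
    show "card {w \<in> ?A. order w = xs} = card {w \<in> ?A. order w = us}"
      if "xs \<in> permutations_of_set (set us)" for xs
    proof -
      have xs: "distinct xs" "set xs = set us" using that by (auto simp: permutations_of_set_def)
      obtain \<sigma> where \<sigma>: "\<sigma> permutes set us" "map \<sigma> xs = us"
        using us(1) xs permutes_map_list[of "set us" xs us] by (metis List.finite_set distinct_card order_refl)
      have v: "\<sigma> v = v" if "v \<in> set vs" for v
        using that us(3) \<sigma>(1) by (meson disjoint_iff permutes_not_in)
      have p: "pos (map \<sigma> w) (\<sigma> x) = pos w x" for w x
        using permutes_inj[OF \<sigma>(1)] by (rule pos_map)
      have 1: "map (pos (map \<sigma> w)) vs = map (pos w) vs" for w
        using v p by (metis (mono_tags, lifting) map_eq_conv)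
      have 2: "map (pos (map \<sigma> w)) us = map (pos w) xs" for w
        unfolding \<sigma>(2)[symmetric] using p by simp
      have \<sigma>': "\<sigma> permutes {1..n}" using \<sigma>(1) us(2) by (rule permutes_subset)
      have "card {w \<in> perms n. map (pos w) vs = js \<and> order w = xs} = card {w \<in> perms n. map (pos w) vs = js \<and> order w = us}"
      proof (rule card_perms_relabel[OF \<sigma>'])
        fix w assume w: "w \<in> perms n"
        then have "map \<sigma> w \<in> perms n" using map_mem_perms_iff[OF \<sigma>'] by blast
        moreover have "us \<in> permutations_of_set (set us)" using us(1) by (simp add: permutations_of_set_def)
        ultimately show "(map (pos (map \<sigma> w)) vs = js \<and> order (map \<sigma> w) = us) \<longleftrightarrow> (map (pos w) vs = js \<and> order w = xs)"
          using order_iff[OF w that] order_iff[of "map \<sigma> w" us] 1 2 by metis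
      qed
      then show ?thesis by (simp add: conj_assoc)
    qed
  qed simp_all
  moreover have "{w \<in> ?A. order w = us} = {w \<in> perms n. map (pos w) vs = js \<and> sorted_wrt (<) (map (pos w) us)}"
    using order_iff[of _ us] us(1) by (auto simp: permutations_of_set_def)
  ultimately show ?thesis
    using card_perms_fixed[OF vs js len] us(1) by (simp add: distinct_card)
qed

text \<open>One disjunct for each glob pattern, in the order of the theorem, except that
  \<open>p 2 = 0 \<and> p (n - 1) = 1 \<and> p (n - 2) < p n\<close> covers 4(d) and 5(a), and that 5(e) takes up two disjuncts.\<close>

definition glob_shape :: "(nat \<Rightarrow> nat) \<Rightarrow> nat \<Rightarrow> bool" where
  "glob_shape p n \<longleftrightarrow>
     p n = 0 \<and> p 2 = 1 \<and> p (n - 1) = 2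
   \<or> p n = 0 \<and> p 1 = 1 \<and> p (n - 1) = 3
   \<or> p n = 0 \<and> p 1 = 2 \<and> p (n - 1) = 3
   \<or> p n = 0 \<and> p 1 = 1 \<and> p (n - 2) = 2 \<and> p (n - 3) < p (n - 1)
   \<or> p n = 0 \<and> p (n - 1) = 1 \<and> p 1 = 2 \<and> p (n - 2) = 3
   \<or> p 3 = 0 \<and> p n = 1
   \<or> p n = 1 \<and> p 1 = 2 \<and> p (n - 1) = 3 \<and> p 2 \<noteq> 0
   \<or> p (n - 1) = 0 \<and> p n = 1 \<and> p 1 = 2 \<and> p (n - 2) = 3
   \<or> p 2 = 1 \<and> p n = 2 \<and> p 1 \<noteq> 0
   \<or> p 2 = 0 \<and> p n = 2 \<and> p 1 \<noteq> 1
   \<or> p 1 = 0 \<and> p n = 3 \<and> \<not> (p (n - 1) = 1 \<and> p (n - 2) = 2)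
   \<or> p 1 = 1 \<and> p n = 3
   \<or> p 1 = 2 \<and> p n = 3
   \<or> p 2 = 0 \<and> p (n - 1) = 1 \<and> p (n - 2) < p n
   \<or> p 1 = 0 \<and> p (n - 2) = 1 \<and> p (n - 1) = 2 \<and> p (n - 3) < p n
   \<or> p 1 = 0 \<and> p (n - 2) = 1 \<and> p (n - 3) < p (n - 1) \<and> p (n - 1) < p n
   \<or> p 1 = 0 \<and> p (n - 2) = 1 \<and> p (n - 3) < p n \<and> p (n - 4) < p n \<and> p n < p (n - 1)
   \<or> p 1 = 1 \<and> p (n - 1) = 2 \<and> 2 < p (n - 2) \<and> p (n - 2) < p n
   \<or> p 1 = 0 \<and> p (n - 1) = 2 \<and> 2 < p (n - 2) \<and> p (n - 2) < p n
   \<or> p (n - 2) = 0 \<and> p 1 = 1 \<and> p (n - 1) = 2 \<and> p (n - 3) < p n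
   \<or> p (n - 1) = 0 \<and> p 1 = 1 \<and> p (n - 2) = 2 \<and> p (n - 3) < p n
   \<or> p 1 = 0 \<and> p (n - 1) = 1 \<and> p (n - 3) < p n \<and> p (n - 4) < p n \<and> p n < p (n - 2)"

section \<open>Lag conditions and glob patterns reduced to the same condition on positions\<close>

lemma diff_of_bool_eq_iff:
  fixes x y :: nat
  assumes "x \<noteq> y"
  shows "y - of_bool (x < y) = k \<longleftrightarrow> (if x \<le> k then y = Suc k else y = k)"
  using assms by (auto simp: not_le)

lemma diff_of_bool_less_iff:
  fixes x y z :: nat
  assumes "x \<noteq> y" "x \<noteq> z"
  shows "y - of_bool (x < y) < z - of_bool (x < z) \<longleftrightarrow> y < z"
  using assms by (auto simp: not_less)

text \<open>The conditions compare positions with each other and with constants up to 3, so larger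
  values need no further distinction.\<close>

lemma nat_cases_4:
  fixes n :: nat
  obtains "n = 0" | "n = Suc 0" | "n = Suc (Suc 0)" | "n = Suc (Suc (Suc 0))" | k where "n = Suc (Suc (Suc (Suc k)))"
  by (metis not0_implies_Suc)

text \<open>The functions \<open>q\<close> and \<open>r\<close> are the position functions after the deletion of 1 and of 1, 2.  If
  \<open>n = 6\<close> then 2, 3 coincide with \<open>n - 4\<close>, \<open>n - 3\<close>, so the proof does not use that all eight positions
  are distinct.\<close>

lemma lag_shape_iff_glob_shape:
  fixes n :: nat
  assumes n: "n \<ge> 6" and inj: "inj_on p {1..n}"
  defines "q \<equiv> \<lambda>x. p x - of_bool (p 1 < p x)"
  defines "r \<equiv> \<lambda>x. q x - of_bool (q 2 < q x)"
  shows "(\<not> (p 1 = 0 \<and> p n = 1) \<and> \<not> lag_1_shape p 1 n \<and> \<not> (q 2 = 0 \<and> q n = 1) \<and>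
    (lag_2_shape p 1 n \<or> lag_1_shape q 2 n \<or> r 3 = 0 \<and> r n = 1)) \<longleftrightarrow> glob_shape p n"
proof -
  define a b c d e s t where defs: "a = p n" "b = p (n - 1)" "c = p (n - 2)" "d = p (n - 3)" "e = p (n - 4)"
    "s = p 3" "t = p 2"
  have eq_iff: "p x = p y \<longleftrightarrow> x = y" if "x \<in> {1..n}" "y \<in> {1..n}" for x y
    using inj_on_eq_iff[OF inj] that by blast
  \<comment> \<open>The lists leave out exactly the pairs of letters that can coincide: 2 = n - 4
    and 3 = n - 3 for n = 6, and 3 = n - 4 for n = 7.\<close>
  have dist: "distinct [p 1, t, a, b, c, d]" "distinct [a, b, c, d, e, p 1]" "distinct [s, t, p 1, a, b, c]"
    unfolding defs using n by (auto simp: eq_iff)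
  have q: "q y = k \<longleftrightarrow> (if p 1 \<le> k then p y = Suc k else p y = k)" if "y \<in> {2..n}" for y k
    unfolding q_def using that by (intro diff_of_bool_eq_iff) (auto simp: eq_iff)
  have q_less: "q y < q z \<longleftrightarrow> p y < p z" if "y \<in> {2..n}" "z \<in> {2..n}" for y z
    unfolding q_def using that by (intro diff_of_bool_less_iff) (auto simp: eq_iff)
  have r: "r y = k \<longleftrightarrow> (if q 2 \<le> k then q y = Suc k else q y = k)" if "y \<in> {3..n}" for y k
  proof -
    have "p 2 \<noteq> p y" using that n by (subst eq_iff) auto
    then have "q 2 \<noteq> q y" using q_less[of 2 y] q_less[of y 2] that n by auto
    then show ?thesis unfolding r_def by (rule diff_of_bool_eq_iff)
  qed
  have r3: "r 3 = 0 \<and> r n = 1 \<longleftrightarrow>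
      (if q 2 = 0 then q 3 = 1 \<and> q n = 2 else q 3 = 0 \<and> (if q 2 = 1 then q n = 2 else q n = 1))"
    using n by (auto simp: r le_Suc_eq)
  have eqs: "q y = 0 \<longleftrightarrow> (if p 1 = 0 then p y = 1 else p y = 0)"
    "q y = 1 \<longleftrightarrow> (if p 1 = 0 \<or> p 1 = 1 then p y = 2 else p y = 1)"
    "q y = 2 \<longleftrightarrow> (if p 1 = 0 \<or> p 1 = 1 \<or> p 1 = 2 then p y = 3 else p y = 2)"
    if "y \<in> {2..n}" for y
    using that by (auto simp: q le_Suc_eq numeral_2_eq_2)
  have mem: "2 \<in> {2..n}" "3 \<in> {2..n}" "n \<in> {2..n}" "n - 1 \<in> {2..n}" "n - 2 \<in> {2..n}" using n by auto
  \<comment> \<open>These rules remove the shift by one in \<open>lag_2_shape\<close>, which occurs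
    for \<open>p 1 = 0\<close>; then every other position is nonzero and no subtraction is
    truncated.\<close>
  have minus1: "y - 1 = k \<longleftrightarrow> y = Suc k" "y - 1 < z - 1 \<longleftrightarrow> y < z" "1 < y - 1 \<longleftrightarrow> 2 < y"
    if "y \<noteq> 0" "z \<noteq> 0" for y z k :: nat using that by auto
  note shapes = lag_1_shape_def lag_2_shape_def defect_2_shape_def glob_shape_def r3 mem[THEN eqs(1)]
    mem[THEN eqs(2)] mem[THEN eqs(3)] q_less[OF mem(5,3)] defs[symmetric]
  note [[linarith_neq_limit = 1]]
  consider "p 1 = 0" | "p 1 = 1" | "p 1 = 2" | "p 1 \<noteq> 0" "p 1 \<noteq> 1" "p 1 \<noteq> 2" by blast
  then show ?thesis
  proof cases
    case 1
    then have nz: "a \<noteq> 0" "b \<noteq> 0" "c \<noteq> 0" "d \<noteq> 0" "e \<noteq> 0" using dist by auto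
    note m = minus1[OF nz(1) nz(2)] minus1[OF nz(2) nz(1)] minus1[OF nz(3) nz(1)] minus1[OF nz(3) nz(2)]
      minus1[OF nz(4) nz(1)] minus1[OF nz(5) nz(1)] minus1[OF nz(1) nz(3)] minus1[OF nz(4) nz(2)]
    show ?thesis
      using dist unfolding shapes m 1
      by (simp add: numeral_eq_Suc) (cases a rule: nat_cases_4; simp; cases b rule: nat_cases_4; simp; cases c rule: nat_cases_4; simp; auto simp: less_Suc_eq)
  next
    case 2
    then show ?thesis
      using dist unfolding shapes 2 
      by (simp add: numeral_eq_Suc) (cases a rule: nat_cases_4; simp; cases b rule: nat_cases_4; simp; cases c rule: nat_cases_4; simp; auto simp: less_Suc_eq)
  next
    case 3
    then show ?thesis
      using dist unfolding shapes 3 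
      by (simp add: numeral_eq_Suc) (cases a rule: nat_cases_4; simp; cases b rule: nat_cases_4; simp; cases c rule: nat_cases_4; simp; auto simp: less_Suc_eq)
  next
    case 4
    then show ?thesis
      using dist unfolding shapes 
      by (simp add: numeral_eq_Suc) (cases a rule: nat_cases_4; simp; cases b rule: nat_cases_4; simp; cases c rule: nat_cases_4; simp; auto simp: less_Suc_eq)
  qed
qed

lemma glob_patterns_iff_glob_shape:
  assumes \<pi>: "\<pi> \<in> perms n" and n: "n \<ge> 6"
  shows "(\<pi> \<in> glob [Star, Lit (n - 1), Lit 2, Lit n]
         \<or> \<pi> \<in> glob [Star, Lit (n - 1), Any, Lit 1, Lit n]
         \<or> \<pi> \<in> glob [Star, Lit (n - 1), Lit 1, Any, Lit n]
         \<or> \<pi> \<in> glob [Star, Lit (n - 1), Star, Lit (n - 3), Star, Lit (n - 2), Lit 1, Lit n]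
         \<or> \<pi> \<in> glob [Star, Lit (n - 2), Lit 1, Lit (n - 1), Lit n]
         \<or> \<pi> \<in> glob [Star, Lit n, Lit 3]
         \<or> \<pi> \<in> glob [Star, Lit (n - 1), Lit 1, Lit n, Any] - glob [Star, Lit (n - 1), Lit 1, Lit n, Lit 2]
         \<or> \<pi> \<in> glob [Star, Lit (n - 2), Lit 1, Lit n, Lit (n - 1)]
         \<or> \<pi> \<in> glob [Star, Lit n, Lit 2, Any] - glob [Star, Lit n, Lit 2, Lit 1]
         \<or> \<pi> \<in> glob [Star, Lit n, Any, Lit 2] - glob [Star, Lit n, Lit 1, Lit 2]
         \<or> \<pi> \<in> glob [Star, Lit n, Any, Any, Lit 1] - glob [Star, Lit n, Lit (n - 2), Lit (n - 1), Lit 1]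
         \<or> \<pi> \<in> glob [Star, Lit n, Any, Lit 1, Any]
         \<or> \<pi> \<in> glob [Star, Lit n, Lit 1, Any, Any]
         \<or> \<pi> \<in> glob [Star, Lit n, Lit (n - 2), Lit (n - 1), Lit 2]
         \<or> (\<exists>X A B. \<pi> = X @ [n] @ A @ [n - 2] @ B @ [n - 1, 2] \<and> \<not> (A = [] \<and> B = []))
         \<or> \<pi> \<in> glob [Star, Lit n, Star, Lit (n - 3), Star, Lit (n - 1), Lit (n - 2), Lit 1]
         \<or> \<pi> \<in> glob [Star, Lit n, Star, Lit (n - 1), Star, Lit (n - 3), Star, Lit (n - 2), Lit 1]
         \<or> \<pi> \<in> glob [Star, Lit (n - 1), Star, Lit n, Star, Lit (n - 3), Star, Lit (n - 4), Star, Lit (n - 2), Lit 1]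
             \<union> glob [Star, Lit (n - 1), Star, Lit n, Star, Lit (n - 4), Star, Lit (n - 3), Star, Lit (n - 2), Lit 1]
         \<or> \<pi> \<in> glob [Star, Lit n, Star, Lit (n - 2), Star, Lit (n - 1), Lit 1, Any]
             \<union> glob [Star, Lit n, Star, Lit (n - 2), Star, Lit (n - 1), Any, Lit 1]
         \<or> \<pi> \<in> glob [Star, Lit n, Star, Lit (n - 3), Star, Lit (n - 1), Lit 1, Lit (n - 2)]
         \<or> \<pi> \<in> glob [Star, Lit n, Star, Lit (n - 3), Star, Lit (n - 2), Lit 1, Lit (n - 1)]
         \<or> \<pi> \<in> glob [Star, Lit (n - 2), Star, Lit n, Star, Lit (n - 3), Star, Lit (n - 4), Star, Lit (n - 1), Lit 1]
             \<union> glob [Star, Lit (n - 2), Star, Lit n, Star, Lit (n - 4), Star, Lit (n - 3), Star, Lit (n - 1), Lit 1])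
    \<longleftrightarrow> glob_shape (pos \<pi>) n"
proof -
  define p where "p = pos \<pi>"
  have w: "distinct \<pi>" "set \<pi> = {1..n}" using \<pi> by (auto simp: permutations_of_set_def)
  have w': "set \<pi> \<subseteq> {1..}" using w(2) by auto
  have len: "length \<pi> = n" using w distinct_card[of \<pi>] by simp
  have mem: "1 \<in> set \<pi>" "2 \<in> set \<pi>" "3 \<in> set \<pi>" "n \<in> set \<pi>" "n - 1 \<in> set \<pi>" "n - 2 \<in> set \<pi>"
    "n - 3 \<in> set \<pi>" "n - 4 \<in> set \<pi>"
    using w n by auto
  note glob_pos = mem_glob_iff_rev[of \<pi>] rev.simps append.simps drop_rev_mem_glob_Star_Nil[OF w(1) w', THEN eqTrueI]
    drop_rev_mem_glob_Any[OF w(1) w'] mem[THEN drop_rev_mem_glob_Lit[OF w(1) w']]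
    mem[THEN drop_rev_mem_glob_Star_Lit[OF w(1) w']] p_def[symmetric] len
  have eq_iff: "p x = p y \<longleftrightarrow> x = y" if "x \<in> {1..n}" "y \<in> {1..n}" for x y
    unfolding p_def using that w pos_inj[of x \<pi> y] by auto
  have ne: "p (n - 3) \<noteq> p n" "p (n - 3) \<noteq> p (n - 1)" "p (n - 3) \<noteq> p (n - 2)" "p (n - 3) \<noteq> p 1"
    "p (n - 4) \<noteq> p n" "p (n - 4) \<noteq> p (n - 1)" "p (n - 4) \<noteq> p (n - 2)" "p (n - 4) \<noteq> p 1"
    "p (n - 3) \<noteq> p (n - 4)" "p (n - 2) \<noteq> p (n - 1)" "p (n - 2) \<noteq> p 1" "p (n - 2) \<noteq> p 2"
    using n by (auto simp: eq_iff)
  have lens: "0 < n" "1 < n" "2 < n" "3 < n" "n \<noteq> 0" "n \<noteq> 1" "n \<noteq> 2" using n by auto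
  have nums: "Suc 0 = 1" "Suc 1 = 2" "Suc 2 = 3" "Suc 3 = 4" by simp_all
  \<comment> \<open>A star before a letter x yields a lower bound on \<open>p x\<close>. Small
    bounds are expanded into \<open>p x\<close> avoiding single values, which distinctness settles
    when the letters at these positions are named in the pattern.\<close>
  have ge: "0 \<le> k \<longleftrightarrow> True" "1 \<le> k \<longleftrightarrow> k \<noteq> 0" "2 \<le> k \<longleftrightarrow> k \<noteq> 0 \<and> k \<noteq> 1" "3 \<le> k \<longleftrightarrow> k \<noteq> 0 \<and> k \<noteq> 1 \<and> k \<noteq> 2"
    "2 < k \<longleftrightarrow> k \<noteq> 0 \<and> k \<noteq> 1 \<and> k \<noteq> 2" for k :: nat by auto
  \<comment> \<open>Pattern 5(a) is a glob pattern with one case taken out: \<open>A\<close> and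
    \<open>B\<close> are both empty iff \<open>n - 2\<close> and \<open>n\<close> have positions 2
    and 3. That case is 4(d), so the two patterns merge into one condition.\<close>
  have 5: "(\<exists>X A B. \<pi> = X @ [n] @ A @ [n - 2] @ B @ [n - 1, 2] \<and> \<not> (A = [] \<and> B = []))
    \<longleftrightarrow> p 2 = 0 \<and> p (n - 1) = 1 \<and> p (n - 2) < p n \<and> \<not> (p (n - 2) = 2 \<and> p n = 3)" (is "?L \<longleftrightarrow> ?R")
  proof
    assume ?L
    then obtain X A B where e: "\<pi> = X @ [n] @ A @ [n - 2] @ B @ [n - 1, 2]" "A \<noteq> [] \<or> B \<noteq> []" by blast
    then have "p 2 = 0" "p (n - 1) = 1" "p (n - 2) = 2 + length B" "p n = 3 + length A + length B"
      using w(1) n unfolding p_def by (auto simp: pos_append pos_Cons)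
    then show ?R using e(2) by auto
  next
    assume R: ?R
    then have "p (n - 2) \<noteq> 0" "p (n - 2) \<noteq> 1" using ne(10,12) by auto
    then have "2 \<le> p (n - 2)" by simp
    then have "\<pi> \<in> glob [Star, Lit n, Star, Lit (n - 2), Star, Lit (n - 1), Lit 2]"
      using R unfolding glob_pos by simp
    then obtain X A B where e: "\<pi> = X @ [n] @ A @ [n - 2] @ B @ [n - 1, 2]" by auto
    then have "p (n - 2) = 2 + length B" "p n = 3 + length A + length B"
      using w(1) n unfolding p_def by (auto simp: pos_append pos_Cons)
    then show ?L using e R by auto
  qed
  have g0: "\<pi> \<in> glob [Star, Lit (n - 1), Lit 2, Lit n] \<longleftrightarrow> p n = 0 \<and> p 2 = 1 \<and> p (n - 1) = 2"
    unfolding glob_pos nums ge Suc_le_eq by ((simp only: lens simp_thms not_False_eq_True)?; insert ne; metis)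
  have g1: "\<pi> \<in> glob [Star, Lit (n - 1), Any, Lit 1, Lit n] \<longleftrightarrow> p n = 0 \<and> p 1 = 1 \<and> p (n - 1) = 3"
    unfolding glob_pos nums ge Suc_le_eq by ((simp only: lens simp_thms not_False_eq_True)?; insert ne; metis)
  have g2: "\<pi> \<in> glob [Star, Lit (n - 1), Lit 1, Any, Lit n] \<longleftrightarrow> p n = 0 \<and> p 1 = 2 \<and> p (n - 1) = 3"
    unfolding glob_pos nums ge Suc_le_eq by ((simp only: lens simp_thms not_False_eq_True)?; insert ne; metis)
  have g3: "\<pi> \<in> glob [Star, Lit (n - 1), Star, Lit (n - 3), Star, Lit (n - 2), Lit 1, Lit n] \<longleftrightarrow> p n = 0 \<and> p 1 = 1 \<and> p (n - 2) = 2 \<and> p (n - 3) < p (n - 1)"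
    unfolding glob_pos nums ge Suc_le_eq by ((simp only: lens simp_thms not_False_eq_True)?; insert ne; metis)
  have g4: "\<pi> \<in> glob [Star, Lit (n - 2), Lit 1, Lit (n - 1), Lit n] \<longleftrightarrow> p n = 0 \<and> p (n - 1) = 1 \<and> p 1 = 2 \<and> p (n - 2) = 3"
    unfolding glob_pos nums ge Suc_le_eq by ((simp only: lens simp_thms not_False_eq_True)?; insert ne; metis)
  have g5: "\<pi> \<in> glob [Star, Lit n, Lit 3] \<longleftrightarrow> p 3 = 0 \<and> p n = 1"
    unfolding glob_pos nums ge Suc_le_eq by ((simp only: lens simp_thms not_False_eq_True)?; insert ne; metis)
  have g6: "\<pi> \<in> glob [Star, Lit (n - 1), Lit 1, Lit n, Any] \<longleftrightarrow> p n = 1 \<and> p 1 = 2 \<and> p (n - 1) = 3"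
    unfolding glob_pos nums ge Suc_le_eq by ((simp only: lens simp_thms not_False_eq_True)?; insert ne; metis)
  have g7: "\<pi> \<in> glob [Star, Lit (n - 1), Lit 1, Lit n, Lit 2] \<longleftrightarrow> p 2 = 0 \<and> p n = 1 \<and> p 1 = 2 \<and> p (n - 1) = 3"
    unfolding glob_pos nums ge Suc_le_eq by ((simp only: lens simp_thms not_False_eq_True)?; insert ne; metis)
  have g8: "\<pi> \<in> glob [Star, Lit (n - 2), Lit 1, Lit n, Lit (n - 1)] \<longleftrightarrow> p (n - 1) = 0 \<and> p n = 1 \<and> p 1 = 2 \<and> p (n - 2) = 3"
    unfolding glob_pos nums ge Suc_le_eq by ((simp only: lens simp_thms not_False_eq_True)?; insert ne; metis)
  have g9: "\<pi> \<in> glob [Star, Lit n, Lit 2, Any] \<longleftrightarrow> p 2 = 1 \<and> p n = 2"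
    unfolding glob_pos nums ge Suc_le_eq by ((simp only: lens simp_thms not_False_eq_True)?; insert ne; metis)
  have g10: "\<pi> \<in> glob [Star, Lit n, Lit 2, Lit 1] \<longleftrightarrow> p 1 = 0 \<and> p 2 = 1 \<and> p n = 2"
    unfolding glob_pos nums ge Suc_le_eq by ((simp only: lens simp_thms not_False_eq_True)?; insert ne; metis)
  have g11: "\<pi> \<in> glob [Star, Lit n, Any, Lit 2] \<longleftrightarrow> p 2 = 0 \<and> p n = 2"
    unfolding glob_pos nums ge Suc_le_eq by ((simp only: lens simp_thms not_False_eq_True)?; insert ne; metis)
  have g12: "\<pi> \<in> glob [Star, Lit n, Lit 1, Lit 2] \<longleftrightarrow> p 2 = 0 \<and> p 1 = 1 \<and> p n = 2"
    unfolding glob_pos nums ge Suc_le_eq by ((simp only: lens simp_thms not_False_eq_True)?; insert ne; metis)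
  have g13: "\<pi> \<in> glob [Star, Lit n, Any, Any, Lit 1] \<longleftrightarrow> p 1 = 0 \<and> p n = 3"
    unfolding glob_pos nums ge Suc_le_eq by ((simp only: lens simp_thms not_False_eq_True)?; insert ne; metis)
  have g14: "\<pi> \<in> glob [Star, Lit n, Lit (n - 2), Lit (n - 1), Lit 1] \<longleftrightarrow> p 1 = 0 \<and> p (n - 1) = 1 \<and> p (n - 2) = 2 \<and> p n = 3"
    unfolding glob_pos nums ge Suc_le_eq by ((simp only: lens simp_thms not_False_eq_True)?; insert ne; metis)
  have g15: "\<pi> \<in> glob [Star, Lit n, Any, Lit 1, Any] \<longleftrightarrow> p 1 = 1 \<and> p n = 3"
    unfolding glob_pos nums ge Suc_le_eq by ((simp only: lens simp_thms not_False_eq_True)?; insert ne; metis)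
  have g16: "\<pi> \<in> glob [Star, Lit n, Lit 1, Any, Any] \<longleftrightarrow> p 1 = 2 \<and> p n = 3"
    unfolding glob_pos nums ge Suc_le_eq by ((simp only: lens simp_thms not_False_eq_True)?; insert ne; metis)
  have g17: "\<pi> \<in> glob [Star, Lit n, Lit (n - 2), Lit (n - 1), Lit 2] \<longleftrightarrow> p 2 = 0 \<and> p (n - 1) = 1 \<and> p (n - 2) = 2 \<and> p n = 3"
    unfolding glob_pos nums ge Suc_le_eq by ((simp only: lens simp_thms not_False_eq_True)?; insert ne; metis)
  have g18: "\<pi> \<in> glob [Star, Lit n, Star, Lit (n - 3), Star, Lit (n - 1), Lit (n - 2), Lit 1] \<longleftrightarrow> p 1 = 0 \<and> p (n - 2) = 1 \<and> p (n - 1) = 2 \<and> p (n - 3) < p n"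
    unfolding glob_pos nums ge Suc_le_eq by ((simp only: lens simp_thms not_False_eq_True)?; insert ne; metis)
  have g19: "\<pi> \<in> glob [Star, Lit n, Star, Lit (n - 1), Star, Lit (n - 3), Star, Lit (n - 2), Lit 1] \<longleftrightarrow> p 1 = 0 \<and> p (n - 2) = 1 \<and> p (n - 3) < p (n - 1) \<and> p (n - 1) < p n"
    unfolding glob_pos nums ge Suc_le_eq by ((simp only: lens simp_thms not_False_eq_True)?; insert ne; metis)
  have g20: "\<pi> \<in> glob [Star, Lit (n - 1), Star, Lit n, Star, Lit (n - 3), Star, Lit (n - 4), Star, Lit (n - 2), Lit 1] \<longleftrightarrow> p 1 = 0 \<and> p (n - 2) = 1 \<and> p (n - 4) < p (n - 3) \<and> p (n - 3) < p n \<and> p n < p (n - 1)"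
    unfolding glob_pos nums ge Suc_le_eq by ((simp only: lens simp_thms not_False_eq_True)?; insert ne; metis)
  have g21: "\<pi> \<in> glob [Star, Lit (n - 1), Star, Lit n, Star, Lit (n - 4), Star, Lit (n - 3), Star, Lit (n - 2), Lit 1] \<longleftrightarrow> p 1 = 0 \<and> p (n - 2) = 1 \<and> p (n - 3) < p (n - 4) \<and> p (n - 4) < p n \<and> p n < p (n - 1)"
    unfolding glob_pos nums ge Suc_le_eq by ((simp only: lens simp_thms not_False_eq_True)?; insert ne; metis)
  have g22: "\<pi> \<in> glob [Star, Lit n, Star, Lit (n - 2), Star, Lit (n - 1), Lit 1, Any] \<longleftrightarrow> p 1 = 1 \<and> p (n - 1) = 2 \<and> 2 < p (n - 2) \<and> p (n - 2) < p n"
    unfolding glob_pos nums ge Suc_le_eq by ((simp only: lens simp_thms not_False_eq_True)?; insert ne; metis)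
  have g23: "\<pi> \<in> glob [Star, Lit n, Star, Lit (n - 2), Star, Lit (n - 1), Any, Lit 1] \<longleftrightarrow> p 1 = 0 \<and> p (n - 1) = 2 \<and> 2 < p (n - 2) \<and> p (n - 2) < p n"
    unfolding glob_pos nums ge Suc_le_eq by ((simp only: lens simp_thms not_False_eq_True)?; insert ne; metis)
  have g24: "\<pi> \<in> glob [Star, Lit n, Star, Lit (n - 3), Star, Lit (n - 1), Lit 1, Lit (n - 2)] \<longleftrightarrow> p (n - 2) = 0 \<and> p 1 = 1 \<and> p (n - 1) = 2 \<and> p (n - 3) < p n"
    unfolding glob_pos nums ge Suc_le_eq by ((simp only: lens simp_thms not_False_eq_True)?; insert ne; metis)
  have g25: "\<pi> \<in> glob [Star, Lit n, Star, Lit (n - 3), Star, Lit (n - 2), Lit 1, Lit (n - 1)] \<longleftrightarrow> p (n - 1) = 0 \<and> p 1 = 1 \<and> p (n - 2) = 2 \<and> p (n - 3) < p n"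
    unfolding glob_pos nums ge Suc_le_eq by ((simp only: lens simp_thms not_False_eq_True)?; insert ne; metis)
  have g26: "\<pi> \<in> glob [Star, Lit (n - 2), Star, Lit n, Star, Lit (n - 3), Star, Lit (n - 4), Star, Lit (n - 1), Lit 1] \<longleftrightarrow> p 1 = 0 \<and> p (n - 1) = 1 \<and> p (n - 4) < p (n - 3) \<and> p (n - 3) < p n \<and> p n < p (n - 2)"
    unfolding glob_pos nums ge Suc_le_eq by ((simp only: lens simp_thms not_False_eq_True)?; insert ne; metis)
  have g27: "\<pi> \<in> glob [Star, Lit (n - 2), Star, Lit n, Star, Lit (n - 4), Star, Lit (n - 3), Star, Lit (n - 1), Lit 1] \<longleftrightarrow> p 1 = 0 \<and> p (n - 1) = 1 \<and> p (n - 3) < p (n - 4) \<and> p (n - 4) < p n \<and> p n < p (n - 2)"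
    unfolding glob_pos nums ge Suc_le_eq by ((simp only: lens simp_thms not_False_eq_True)?; insert ne; metis)
  \<comment> \<open>The words taken away in this and the next three differences have complexity at
    least n - 2: in the first three the deletion of 1 leaves a word that ends in n 2, so the letter
    2 has lag 0, and in the last one the letter 1 has lag 1.\<close>
  have d6: "\<pi> \<in> glob [Star, Lit (n - 1), Lit 1, Lit n, Any] - glob [Star, Lit (n - 1), Lit 1, Lit n, Lit 2] \<longleftrightarrow> p n = 1 \<and> p 1 = 2 \<and> p (n - 1) = 3 \<and> p 2 \<noteq> 0"
    unfolding Diff_iff g6 g7 by auto
  have d9: "\<pi> \<in> glob [Star, Lit n, Lit 2, Any] - glob [Star, Lit n, Lit 2, Lit 1] \<longleftrightarrow> p 2 = 1 \<and> p n = 2 \<and> p 1 \<noteq> 0"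
    unfolding Diff_iff g9 g10 by auto
  have d11: "\<pi> \<in> glob [Star, Lit n, Any, Lit 2] - glob [Star, Lit n, Lit 1, Lit 2] \<longleftrightarrow> p 2 = 0 \<and> p n = 2 \<and> p 1 \<noteq> 1"
    unfolding Diff_iff g11 g12 by auto
  have d13: "\<pi> \<in> glob [Star, Lit n, Any, Any, Lit 1] - glob [Star, Lit n, Lit (n - 2), Lit (n - 1), Lit 1] \<longleftrightarrow> p 1 = 0 \<and> p n = 3 \<and> \<not> (p (n - 1) = 1 \<and> p (n - 2) = 2)"
    unfolding Diff_iff g13 g14 by auto
  \<comment> \<open>The two globs of 5(d), and likewise of 5(h), differ only in the order of
    \<open>n - 3\<close> and \<open>n - 4\<close>; together they say that both letters stand to the
    right of \<open>n\<close>.\<close>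
  have swap: "x < m \<and> y < m \<longleftrightarrow> x < y \<and> y < m \<or> y < x \<and> x < m" if "x \<noteq> y" for x y m :: nat
    using that by auto
  have u20: "\<pi> \<in> glob [Star, Lit (n - 1), Star, Lit n, Star, Lit (n - 3), Star, Lit (n - 4), Star, Lit (n - 2), Lit 1] \<union> glob [Star, Lit (n - 1), Star, Lit n, Star, Lit (n - 4), Star, Lit (n - 3), Star, Lit (n - 2), Lit 1] \<longleftrightarrow> p 1 = 0 \<and> p (n - 2) = 1 \<and> p (n - 3) < p n \<and> p (n - 4) < p n \<and> p n < p (n - 1)"
    unfolding Un_iff g20 g21 using swap[OF ne(9), of "p n"] by metis
  have u26: "\<pi> \<in> glob [Star, Lit (n - 2), Star, Lit n, Star, Lit (n - 3), Star, Lit (n - 4), Star, Lit (n - 1), Lit 1] \<union> glob [Star, Lit (n - 2), Star, Lit n, Star, Lit (n - 4), Star, Lit (n - 3), Star, Lit (n - 1), Lit 1] \<longleftrightarrow> p 1 = 0 \<and> p (n - 1) = 1 \<and> p (n - 3) < p n \<and> p (n - 4) < p n \<and> p n < p (n - 2)"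
    unfolding Un_iff g26 g27 using swap[OF ne(9), of "p n"] by metis
  have u22: "\<pi> \<in> glob [Star, Lit n, Star, Lit (n - 2), Star, Lit (n - 1), Lit 1, Any] \<union> glob [Star, Lit n, Star, Lit (n - 2), Star, Lit (n - 1), Any, Lit 1]
      \<longleftrightarrow> p 1 = 1 \<and> p (n - 1) = 2 \<and> 2 < p (n - 2) \<and> p (n - 2) < p n \<or> p 1 = 0 \<and> p (n - 1) = 2 \<and> 2 < p (n - 2) \<and> p (n - 2) < p n"
    unfolding Un_iff g22 g23 ..
  have merge: "p 2 = 0 \<and> p (n - 1) = 1 \<and> p (n - 2) = 2 \<and> p n = 3
      \<or> p 2 = 0 \<and> p (n - 1) = 1 \<and> p (n - 2) < p n \<and> \<not> (p (n - 2) = 2 \<and> p n = 3)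
    \<longleftrightarrow> p 2 = 0 \<and> p (n - 1) = 1 \<and> p (n - 2) < p n" (is "?X \<or> ?Y \<longleftrightarrow> ?Z")
    by auto
  have tail: "?X \<or> ?Y \<or> R \<longleftrightarrow> ?Z \<or> R" for R using merge by blast
  have cong: "P = Q \<Longrightarrow> (A \<or> P) = (A \<or> Q)" for A P Q by simp
  show ?thesis
    unfolding 5 d6 d9 d11 d13 u20 u22 u26 g0 g1 g2 g3 g4 g5 g8 g15 g16 g17 g18 g19 g24 g25 glob_shape_def p_def[symmetric] disj_assoc
    by ((rule cong)+, rule tail)
qed

section \<open>The count\<close>

text \<open>Positions grow from right to left, so \<open>us\<close> lists the ordered letters from
  the rightmost to the leftmost.\<close>

definition placed :: "nat list \<Rightarrow> nat list \<Rightarrow> nat list \<Rightarrow> (nat \<Rightarrow> nat) \<Rightarrow> bool" where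
  "placed vs js us p \<longleftrightarrow> map p vs = js \<and> sorted_wrt (<) (map p us)"

lemma card_placed:
  assumes "distinct vs" "set vs \<subseteq> {1..n}" "distinct js" "set js \<subseteq> {..<n}" "length vs = length js"
    "distinct us" "set us \<subseteq> {1..n}" "set us \<inter> set vs = {}"
  shows "real (card (perms n \<inter> {w. placed vs js us (pos w)})) = fact (n - length vs) / fact (length us)"
proof -
  have "fact (length us) * real (card (perms n \<inter> {w. placed vs js us (pos w)})) = fact (n - length vs)"
    unfolding placed_def Int_def mem_Collect_eq using card_perms_fixed_ordered[OF assms]
    by (metis (no_types, lifting) of_nat_fact of_nat_mult)
  then show ?thesis by (simp add: field_simps)
qed

text \<open>Ten terms with \<open>p 1 = 0\<close>, seven with \<open>p 1 = 1\<close>, seven with \<open>p 1 = 2\<close>, and seven for the patterns that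
  do not mention 1, corrected for what the former terms already cover.\<close>

lemma of_bool_glob_shape:
  fixes n :: nat
  assumes n: "n \<ge> 6" and inj: "inj_on p {1..n}"
  shows "(of_bool (glob_shape p n) :: real) =
     of_bool (placed [1, n] [0, 3] [] p) - of_bool (placed [1, n, n - 1, n - 2] [0, 3, 1, 2] [] p)
      + of_bool (placed [1, n - 2, n - 1] [0, 1, 2] [n - 3, n] p) + of_bool (placed [1, n - 2] [0, 1] [n - 3, n - 1, n] p)
      + of_bool (placed [1, n - 2] [0, 1] [n - 3, n - 4, n, n - 1] p) + of_bool (placed [1, n - 2] [0, 1] [n - 4, n - 3, n, n - 1] p)
      + of_bool (placed [1, n - 1] [0, 2] [n - 2, n] p) - of_bool (placed [1, n - 1, n - 2] [0, 2, 1] [] p)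
      + of_bool (placed [1, n - 1] [0, 1] [n - 3, n - 4, n, n - 2] p) + of_bool (placed [1, n - 1] [0, 1] [n - 4, n - 3, n, n - 2] p)
      + of_bool (placed [1, n, n - 1] [1, 0, 3] [] p) + of_bool (placed [1, n, n - 2] [1, 0, 2] [n - 3, n - 1] p)
      + of_bool (placed [1, n] [1, 3] [] p) + of_bool (placed [1, n - 1] [1, 2] [n - 2, n] p)
      - of_bool (placed [1, n - 1, n - 2] [1, 2, 0] [] p) + of_bool (placed [1, n - 2, n - 1] [1, 0, 2] [n - 3, n] p)
      + of_bool (placed [1, n - 1, n - 2] [1, 0, 2] [n - 3, n] p) + of_bool (placed [1, n, n - 1] [2, 0, 3] [] p)
      + of_bool (placed [1, n, n - 1, n - 2] [2, 0, 1, 3] [] p) + of_bool (placed [1, n, n - 1] [2, 1, 3] [] p)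
      - of_bool (placed [1, n, n - 1, 2] [2, 1, 3, 0] [] p) + of_bool (placed [1, n - 1, n, n - 2] [2, 0, 1, 3] [] p)
      + of_bool (placed [1, n] [2, 3] [] p) - of_bool (placed [1, 3, n, n - 1] [2, 0, 1, 3] [] p)
      + of_bool (placed [n, 2, n - 1] [0, 1, 2] [] p) + of_bool (placed [3, n] [0, 1] [] p)
      + of_bool (placed [n, 2] [2, 1] [] p) - of_bool (placed [n, 2, 1] [2, 1, 0] [] p)
      + of_bool (placed [2, n] [0, 2] [] p) - of_bool (placed [2, n, 1] [0, 2, 1] [] p)
      + of_bool (placed [2, n - 1] [0, 1] [n - 2, n] p)"
proof -
  define a b c d e s t where defs: "a = p n" "b = p (n - 1)" "c = p (n - 2)" "d = p (n - 3)" "e = p (n - 4)"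
    "s = p 3" "t = p 2"
  have eq_iff: "p x = p y \<longleftrightarrow> x = y" if "x \<in> {1..n}" "y \<in> {1..n}" for x y
    using inj_on_eq_iff[OF inj] that by blast
  have dist: "distinct [p 1, t, a, b, c, d]" "distinct [a, b, c, d, e, p 1]" "distinct [s, t, p 1, a, b, c]"
    unfolding defs using n by (auto simp: eq_iff)
  note shapes = glob_shape_def placed_def list.map sorted_wrt.simps list.set list.inject defs[symmetric]
  note [[linarith_neq_limit = 1, linarith_split_limit = 0]]
  note of_bool_conj [simp del] of_bool_or_iff [simp del] split_of_bool [split del]
  consider "p 1 = 0" | "p 1 = 1" | "p 1 = 2" | "p 1 \<noteq> 0" "p 1 \<noteq> 1" "p 1 \<noteq> 2" by blast
  then show ?thesis
  proof cases
    case 1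
    then have "distinct [a, b, c, d, e]" "a \<noteq> 0" "b \<noteq> 0" "c \<noteq> 0" "d \<noteq> 0" "e \<noteq> 0" "t \<noteq> 0" "s \<noteq> 0"
      using dist by auto
    \<comment> \<open>Only for \<open>p 1 = 0\<close> do terms mention \<open>n - 4\<close> and its
      order relative to \<open>n - 3\<close> and \<open>n\<close>, which is why this case needs the
      additional comparisons of \<open>d\<close>, \<open>e\<close> and \<open>a\<close>.\<close>
    then show ?thesis using 1 unfolding shapes
      by (simp add: numeral_eq_Suc) (cases b rule: nat_cases_4; simp; cases c rule: nat_cases_4; simp; cases a rule: nat_cases_4; simp;
        cases d e rule: linorder_cases; simp; cases d a rule: linorder_cases; simp; cases e a rule: linorder_cases; simp;
        auto split: split_of_bool; simp add: less_Suc_eq)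
  next
    case 2
    then show ?thesis using dist unfolding shapes
      by (simp add: numeral_eq_Suc) (cases b rule: nat_cases_4; simp; cases c rule: nat_cases_4; simp; cases a rule: nat_cases_4; simp;
        auto simp: less_Suc_eq split: split_of_bool)
  next
    case 3
    then show ?thesis using dist unfolding shapes
      by (simp add: numeral_eq_Suc) (cases b rule: nat_cases_4; simp; cases c rule: nat_cases_4; simp; cases a rule: nat_cases_4; simp;
        auto simp: less_Suc_eq split: split_of_bool)
  next
    case 4
    then show ?thesis using dist unfolding shapes
      by (simp add: numeral_eq_Suc) (cases b rule: nat_cases_4; simp; cases c rule: nat_cases_4; simp; cases a rule: nat_cases_4; simp;
        auto simp: less_Suc_eq split: split_of_bool)
  qed
qed

lemma card_glob_shape:
  assumes n: "n \<ge> 6"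
  shows "real (card {w \<in> perms n. glob_shape (pos w) n}) =
    fact (n - 4) / 3 * (47 * real ((n - 6) choose 2) + 194 * real ((n - 6) choose 1) + 297)"
proof -
  have inj: "inj_on (pos w) {1..n}" if "w \<in> perms n" for w
    using that by (auto simp: permutations_of_set_def intro!: inj_onI pos_inj[of _ w])
  obtain m where m: "n = m + 6" using n by (metis le_add_diff_inverse2)
  have choose: "real (m choose 2) = real m * (real m - 1) / 2"
    by (induction m) (simp_all add: numeral_2_eq_2 field_simps)
  have facts: "fact (n - 2) = (real m + 4) * (real m + 3) * fact (n - 4)" "fact (n - 3) = (real m + 3) * fact (n - 4)"
    by (simp_all add: m numeral_eq_Suc algebra_simps)
  have "real (card {w \<in> perms n. glob_shape (pos w) n}) = (\<Sum>w\<in>perms n. of_bool (glob_shape (pos w) n))"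
    by (simp add: of_bool_def sum.If_cases Int_def)
  also have "\<dots> = (\<Sum>w\<in>perms n.
     of_bool (placed [1, n] [0, 3] [] (pos w)) - of_bool (placed [1, n, n - 1, n - 2] [0, 3, 1, 2] [] (pos w))
      + of_bool (placed [1, n - 2, n - 1] [0, 1, 2] [n - 3, n] (pos w)) + of_bool (placed [1, n - 2] [0, 1] [n - 3, n - 1, n] (pos w))
      + of_bool (placed [1, n - 2] [0, 1] [n - 3, n - 4, n, n - 1] (pos w)) + of_bool (placed [1, n - 2] [0, 1] [n - 4, n - 3, n, n - 1] (pos w))
      + of_bool (placed [1, n - 1] [0, 2] [n - 2, n] (pos w)) - of_bool (placed [1, n - 1, n - 2] [0, 2, 1] [] (pos w))
      + of_bool (placed [1, n - 1] [0, 1] [n - 3, n - 4, n, n - 2] (pos w)) + of_bool (placed [1, n - 1] [0, 1] [n - 4, n - 3, n, n - 2] (pos w))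
      + of_bool (placed [1, n, n - 1] [1, 0, 3] [] (pos w)) + of_bool (placed [1, n, n - 2] [1, 0, 2] [n - 3, n - 1] (pos w))
      + of_bool (placed [1, n] [1, 3] [] (pos w)) + of_bool (placed [1, n - 1] [1, 2] [n - 2, n] (pos w))
      - of_bool (placed [1, n - 1, n - 2] [1, 2, 0] [] (pos w)) + of_bool (placed [1, n - 2, n - 1] [1, 0, 2] [n - 3, n] (pos w))
      + of_bool (placed [1, n - 1, n - 2] [1, 0, 2] [n - 3, n] (pos w)) + of_bool (placed [1, n, n - 1] [2, 0, 3] [] (pos w))
      + of_bool (placed [1, n, n - 1, n - 2] [2, 0, 1, 3] [] (pos w)) + of_bool (placed [1, n, n - 1] [2, 1, 3] [] (pos w))
      - of_bool (placed [1, n, n - 1, 2] [2, 1, 3, 0] [] (pos w)) + of_bool (placed [1, n - 1, n, n - 2] [2, 0, 1, 3] [] (pos w))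
      + of_bool (placed [1, n] [2, 3] [] (pos w)) - of_bool (placed [1, 3, n, n - 1] [2, 0, 1, 3] [] (pos w))
      + of_bool (placed [n, 2, n - 1] [0, 1, 2] [] (pos w)) + of_bool (placed [3, n] [0, 1] [] (pos w))
      + of_bool (placed [n, 2] [2, 1] [] (pos w)) - of_bool (placed [n, 2, 1] [2, 1, 0] [] (pos w))
      + of_bool (placed [2, n] [0, 2] [] (pos w)) - of_bool (placed [2, n, 1] [0, 2, 1] [] (pos w))
      + of_bool (placed [2, n - 1] [0, 1] [n - 2, n] (pos w)))"
    by (intro sum.cong refl of_bool_glob_shape n inj)
  also have "\<dots> =
     (\<Sum>w\<in>perms n. of_bool (placed [1, n] [0, 3] [] (pos w))) - (\<Sum>w\<in>perms n. of_bool (placed [1, n, n - 1, n - 2] [0, 3, 1, 2] [] (pos w)))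
      + (\<Sum>w\<in>perms n. of_bool (placed [1, n - 2, n - 1] [0, 1, 2] [n - 3, n] (pos w))) + (\<Sum>w\<in>perms n. of_bool (placed [1, n - 2] [0, 1] [n - 3, n - 1, n] (pos w)))
      + (\<Sum>w\<in>perms n. of_bool (placed [1, n - 2] [0, 1] [n - 3, n - 4, n, n - 1] (pos w))) + (\<Sum>w\<in>perms n. of_bool (placed [1, n - 2] [0, 1] [n - 4, n - 3, n, n - 1] (pos w)))
      + (\<Sum>w\<in>perms n. of_bool (placed [1, n - 1] [0, 2] [n - 2, n] (pos w))) - (\<Sum>w\<in>perms n. of_bool (placed [1, n - 1, n - 2] [0, 2, 1] [] (pos w)))
      + (\<Sum>w\<in>perms n. of_bool (placed [1, n - 1] [0, 1] [n - 3, n - 4, n, n - 2] (pos w))) + (\<Sum>w\<in>perms n. of_bool (placed [1, n - 1] [0, 1] [n - 4, n - 3, n, n - 2] (pos w)))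
      + (\<Sum>w\<in>perms n. of_bool (placed [1, n, n - 1] [1, 0, 3] [] (pos w))) + (\<Sum>w\<in>perms n. of_bool (placed [1, n, n - 2] [1, 0, 2] [n - 3, n - 1] (pos w)))
      + (\<Sum>w\<in>perms n. of_bool (placed [1, n] [1, 3] [] (pos w))) + (\<Sum>w\<in>perms n. of_bool (placed [1, n - 1] [1, 2] [n - 2, n] (pos w)))
      - (\<Sum>w\<in>perms n. of_bool (placed [1, n - 1, n - 2] [1, 2, 0] [] (pos w))) + (\<Sum>w\<in>perms n. of_bool (placed [1, n - 2, n - 1] [1, 0, 2] [n - 3, n] (pos w)))
      + (\<Sum>w\<in>perms n. of_bool (placed [1, n - 1, n - 2] [1, 0, 2] [n - 3, n] (pos w))) + (\<Sum>w\<in>perms n. of_bool (placed [1, n, n - 1] [2, 0, 3] [] (pos w)))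
      + (\<Sum>w\<in>perms n. of_bool (placed [1, n, n - 1, n - 2] [2, 0, 1, 3] [] (pos w))) + (\<Sum>w\<in>perms n. of_bool (placed [1, n, n - 1] [2, 1, 3] [] (pos w)))
      - (\<Sum>w\<in>perms n. of_bool (placed [1, n, n - 1, 2] [2, 1, 3, 0] [] (pos w))) + (\<Sum>w\<in>perms n. of_bool (placed [1, n - 1, n, n - 2] [2, 0, 1, 3] [] (pos w)))
      + (\<Sum>w\<in>perms n. of_bool (placed [1, n] [2, 3] [] (pos w))) - (\<Sum>w\<in>perms n. of_bool (placed [1, 3, n, n - 1] [2, 0, 1, 3] [] (pos w)))
      + (\<Sum>w\<in>perms n. of_bool (placed [n, 2, n - 1] [0, 1, 2] [] (pos w))) + (\<Sum>w\<in>perms n. of_bool (placed [3, n] [0, 1] [] (pos w)))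
      + (\<Sum>w\<in>perms n. of_bool (placed [n, 2] [2, 1] [] (pos w))) - (\<Sum>w\<in>perms n. of_bool (placed [n, 2, 1] [2, 1, 0] [] (pos w)))
      + (\<Sum>w\<in>perms n. of_bool (placed [2, n] [0, 2] [] (pos w))) - (\<Sum>w\<in>perms n. of_bool (placed [2, n, 1] [0, 2, 1] [] (pos w)))
      + (\<Sum>w\<in>perms n. of_bool (placed [2, n - 1] [0, 1] [n - 2, n] (pos w)))"
    by (simp only: sum.distrib sum_subtractf)
  also have "\<dots> = fact (n - 2) / 1 - fact (n - 4) / 1 + fact (n - 3) / 2 + fact (n - 2) / 6 + fact (n - 2) / 24 + fact (n - 2) / 24 + fact (n - 2) / 2 - fact (n - 3) / 1 + fact (n - 2) / 24 + fact (n - 2) / 24 + fact (n - 3) / 1 + fact (n - 3) / 2 + fact (n - 2) / 1 + fact (n - 2) / 2 - fact (n - 3) / 1 + fact (n - 3) / 2 + fact (n - 3) / 2 + fact (n - 3) / 1 + fact (n - 4) / 1 + fact (n - 3) / 1 - fact (n - 4) / 1 + fact (n - 4) / 1 + fact (n - 2) / 1 - fact (n - 4) / 1 + fact (n - 3) / 1 + fact (n - 2) / 1 + fact (n - 2) / 1 - fact (n - 3) / 1 + fact (n - 2) / 1 - fact (n - 3) / 1 + fact (n - 2) / 2"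
    unfolding m by (simp add: card_placed fact_numeral del: One_nat_def)
  \<comment> \<open>The terms add up to 47/6 (n - 2)! + 2 (n - 3)! - (n - 4)!. Dividing by (n -
    4)!/3 leaves a quadratic polynomial in m = n - 6, whose coefficients in the basis of binomial
    coefficients are 47, 194 and 297.\<close>
  also have "\<dots> = fact (n - 4) / 3 * (47 * real ((n - 6) choose 2) + 194 * real ((n - 6) choose 1) + 297)"
    unfolding facts by (simp add: m choose field_simps)
  finally show ?thesis .
qed

theorem theorem2p1:
  fixes n :: nat
  assumes "n \<ge> 6"
  shows "(\<forall>\<pi> \<in> perms n. \<pi> \<in> E n (n - 3) \<longleftrightarrow>
           \<pi> \<in> glob [Star, Lit (n - 1), Lit 2, Lit n]
         \<or> \<pi> \<in> glob [Star, Lit (n - 1), Any, Lit 1, Lit n]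
         \<or> \<pi> \<in> glob [Star, Lit (n - 1), Lit 1, Any, Lit n]
         \<or> \<pi> \<in> glob [Star, Lit (n - 1), Star, Lit (n - 3), Star, Lit (n - 2), Lit 1, Lit n]
         \<or> \<pi> \<in> glob [Star, Lit (n - 2), Lit 1, Lit (n - 1), Lit n]
         \<or> \<pi> \<in> glob [Star, Lit n, Lit 3]
         \<or> \<pi> \<in> glob [Star, Lit (n - 1), Lit 1, Lit n, Any] - glob [Star, Lit (n - 1), Lit 1, Lit n, Lit 2]
         \<or> \<pi> \<in> glob [Star, Lit (n - 2), Lit 1, Lit n, Lit (n - 1)]
         \<or> \<pi> \<in> glob [Star, Lit n, Lit 2, Any] - glob [Star, Lit n, Lit 2, Lit 1]
         \<or> \<pi> \<in> glob [Star, Lit n, Any, Lit 2] - glob [Star, Lit n, Lit 1, Lit 2]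
         \<or> \<pi> \<in> glob [Star, Lit n, Any, Any, Lit 1] - glob [Star, Lit n, Lit (n - 2), Lit (n - 1), Lit 1]
         \<or> \<pi> \<in> glob [Star, Lit n, Any, Lit 1, Any]
         \<or> \<pi> \<in> glob [Star, Lit n, Lit 1, Any, Any]
         \<or> \<pi> \<in> glob [Star, Lit n, Lit (n - 2), Lit (n - 1), Lit 2]
         \<or> (\<exists>X A B. \<pi> = X @ [n] @ A @ [n - 2] @ B @ [n - 1, 2] \<and> \<not> (A = [] \<and> B = []))
         \<or> \<pi> \<in> glob [Star, Lit n, Star, Lit (n - 3), Star, Lit (n - 1), Lit (n - 2), Lit 1]
         \<or> \<pi> \<in> glob [Star, Lit n, Star, Lit (n - 1), Star, Lit (n - 3), Star, Lit (n - 2), Lit 1]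
         \<or> \<pi> \<in> glob [Star, Lit (n - 1), Star, Lit n, Star, Lit (n - 3), Star, Lit (n - 4), Star, Lit (n - 2), Lit 1]
             \<union> glob [Star, Lit (n - 1), Star, Lit n, Star, Lit (n - 4), Star, Lit (n - 3), Star, Lit (n - 2), Lit 1]
         \<or> \<pi> \<in> glob [Star, Lit n, Star, Lit (n - 2), Star, Lit (n - 1), Lit 1, Any]
             \<union> glob [Star, Lit n, Star, Lit (n - 2), Star, Lit (n - 1), Any, Lit 1]
         \<or> \<pi> \<in> glob [Star, Lit n, Star, Lit (n - 3), Star, Lit (n - 1), Lit 1, Lit (n - 2)]
         \<or> \<pi> \<in> glob [Star, Lit n, Star, Lit (n - 3), Star, Lit (n - 2), Lit 1, Lit (n - 1)]
         \<or> \<pi> \<in> glob [Star, Lit (n - 2), Star, Lit n, Star, Lit (n - 3), Star, Lit (n - 4), Star, Lit (n - 1), Lit 1]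
             \<union> glob [Star, Lit (n - 2), Star, Lit n, Star, Lit (n - 4), Star, Lit (n - 3), Star, Lit (n - 1), Lit 1])
    \<and> real (card (E n (n - 3))) =
        fact (n - 4) / 3 *
          (47 * real ((n - 6) choose 2) + 194 * real ((n - 6) choose 1) + 297)"
proof -
  have mem: "\<pi> \<in> E n (n - 3) \<longleftrightarrow> glob_shape (pos \<pi>) n" if \<pi>: "\<pi> \<in> perms n" for \<pi>
    unfolding mem_E_iff_pos[OF \<pi> assms]
    using \<pi> by (intro lag_shape_iff_glob_shape[OF assms]) (auto simp: permutations_of_set_def intro!: inj_onI pos_inj[of _ \<pi>])
  have "E n (n - 3) = {\<pi> \<in> perms n. glob_shape (pos \<pi>) n}"
    using mem by (auto simp: E_def)
  then have "real (card (E n (n - 3))) =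
      fact (n - 4) / 3 * (47 * real ((n - 6) choose 2) + 194 * real ((n - 6) choose 1) + 297)"
    using card_glob_shape[OF assms] by simp
  then show ?thesis
    using mem glob_patterns_iff_glob_shape[OF _ assms] by blast
qed

end
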